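(* Let $k\ge 0$ be an integer, $0<\beta<\tfrac12$, and let $X=C^{k,\beta}([-1,1])$ with norm $\|\cdot\|=\|\cdot\|_{k,\beta}$. Let $T:X\to X$ be a Fredholm or Volterra integral operator, let $f$ be a given function in $X$, and assume: (1) the equation $T(y)+f=y$ admits a solution $u\in C^{k,\beta}([-1,1])$ which is isolated and of non-zero index; (2) $T$ is completely continuous and Fréchet differentiable, and $T'$ is bounded, with bound $L$ (i.e. $\|T'(y)\|\le L$ in operator norm); (3) $D\subset X$ is a closed bounded domain containing $u$ such that, for some $\gamma$ with $2\beta<\gamma\le 1$, $T(D)\subset C^{k,\gamma}([-1,1])$, $\inf_{y\in D}\|T(y)\|>0$ and $\sup_{y\in D}\|T(y)\|_{k,\gamma}<\infty$; (4) letting $R$ be the smallest closed subspace of $X$ containing $T(D)$, the projections $P_N$ are uniformly bounded on $R$, and $\|y-P_Ny\|\to 0$ as $N\to\infty$ for each $y\in R$; (5) $1$ is not an eigenvalue of $T'(u)$, so that $(\mathbb 1-T'(u))^{-1}$ exists and is bounded. Then for all $N$ large enough the projected equation $$P_NT(y_N)+P_Nf=y_N$$ admits at least one solution $u_N\in X_N$. Moreover, these solutions $u_N$ satisfy $$\|u-u_N\|\longrightarrow 0\quad\text{as } N\to\infty,$$ with the same rate as $\|P_Nu-u\|\longrightarrow 0$; that is, there are constants $c_1,c_2>0$ such that $c_1\|P_Nu-u\|\le\|u_N-u\|\le c_2\|P_Nu-u\|$ for all $N$ large enough.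
   Context: Hölder spaces: for an integer $k\ge0$ and $0<\beta\le1$, $C^{k,\beta}([-1,1])$ is the Banach space of functions whose $k$-th derivative is Hölder continuous with exponent $\beta$, with norm $\|h\|_{k,\beta}=\max_{r\le k}\|h^{(r)}\|_\infty+\sup_{x\ne y}\frac{|h^{(k)}(x)-h^{(k)}(y)|}{|x-y|^\beta}$. Integral operators: a Fredholm or Volterra integral operator is of the form $T(y)(t)=\int_{-1}^{\alpha(t)}K(y(s),t,s)\,ds$ with kernel $K:\mathbb R\times[-1,1]\times[-1,1]\to\mathbb R$ (possibly nonlinear in its first variable), where $\alpha(t)=1$ (Fredholm) or $\alpha(t)=t$ (Volterra). Chebyshev projection: $C_j$ is the $j$-th Chebyshev polynomial of the first kind, $X_N=\mathrm{span}\{C_0,\dots,C_N\}$, and $P_N:X\to X_N$ is the truncated Chebyshev expansion, $P_Nh=\sum_{j=0}^N a_jC_j$ with $a_j=\frac{2}{\pi}\int_{-1}^1\frac{h(s)C_j(s)}{\sqrt{1-s^2}}ds$ for $j\ge1$ and $a_0=\frac1\pi\int_{-1}^1\frac{h(s)}{\sqrt{1-s^2}}ds$. Index: the index of the isolated solution $u$ is the Leray–Schauder fixed point index of the completely continuous map $y\mapsto T(y)+f$ at $u$, i.e. the degree of $y\mapsto y-T(y)-f$ on small balls about $u$ containing no other solution. $\mathbb 1$ denotes the identity. A map is completely continuous if it is continuous and maps bounded sets to relatively compact sets.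
   Formalization: It is additionally assumed that ‖f − P_N f‖ → 0, without which the claim fails (e.g. T(y)=1, k=0, f=|x|^β); "D containing u" is read as u being an interior point of D, and "these solutions" as those in a fixed small ball about u. *)

theory Defs
  imports "HOL-Analysis.Analysis" "HOL-Homology.Homology" "HOL-Library.Function_Algebras"
begin

section \<open>Functions as a real vector space\<close>

instantiation "fun" :: (type, real_vector) real_vector
begin
definition scaleR_fun :: "real \<Rightarrow> ('a \<Rightarrow> 'b) \<Rightarrow> 'a \<Rightarrow> 'b" where
  "scaleR_fun c f = (\<lambda>x. c *\<^sub>R f x)"
instance
  by standard (auto simp: scaleR_fun_def fun_eq_iff algebra_simps)
end

lemma scaleR_fun_apply [simp]: "(c *\<^sub>R f) x = c *\<^sub>R f x" for f :: "'a \<Rightarrow> 'b::real_vector"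
  by (simp add: scaleR_fun_def)


section \<open>Hoelder spaces on the interval from -1 to 1\<close>

text \<open>
  A function on [-1,1] is represented by its extension by 0 to the whole line, so that equality
  in the space is equality of HOL functions. Derivatives are taken within [-1,1], i.e. they are
  one-sided at the end points.
\<close>

definition deriv_I :: "(real \<Rightarrow> real) \<Rightarrow> real \<Rightarrow> real" where
  "deriv_I h = (\<lambda>x. if x \<in> {-1..1} then vector_derivative h (at x within {-1..1}) else 0)"

definition holder_space :: "nat \<Rightarrow> real \<Rightarrow> (real \<Rightarrow> real) set" where
  "holder_space k \<beta> = {h. (\<forall>x. x \<notin> {-1..1} \<longrightarrow> h x = 0) \<and>
     (\<forall>r<k. (deriv_I ^^ r) h differentiable_on {-1..1}) \<and>
     (\<exists>C. \<forall>x\<in>{-1..1}. \<forall>y\<in>{-1..1}.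
        \<bar>(deriv_I ^^ k) h x - (deriv_I ^^ k) h y\<bar> \<le> C * \<bar>x - y\<bar> powr \<beta>)}"

definition holder_norm :: "nat \<Rightarrow> real \<Rightarrow> (real \<Rightarrow> real) \<Rightarrow> real" where
  "holder_norm k \<beta> h =
     (MAX r\<in>{..k}. SUP x\<in>{-1..1}. \<bar>(deriv_I ^^ r) h x\<bar>) +
     (SUP (x, y)\<in>{(x, y). x \<in> {-1..1} \<and> y \<in> {-1..1} \<and> x \<noteq> y}.
        \<bar>(deriv_I ^^ k) h x - (deriv_I ^^ k) h y\<bar> / \<bar>x - y\<bar> powr \<beta>)"

lemma deriv_I_lincomb:
  assumes "f differentiable_on {-1..1}" "g differentiable_on {-1..1}"
  shows "deriv_I (a *\<^sub>R f + b *\<^sub>R g) = a *\<^sub>R deriv_I f + b *\<^sub>R deriv_I g"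
proof
  fix x :: real
  show "deriv_I (a *\<^sub>R f + b *\<^sub>R g) x = (a *\<^sub>R deriv_I f + b *\<^sub>R deriv_I g) x"
  proof (cases "x \<in> {-1..1}")
    case True
    then have "(f has_vector_derivative deriv_I f x) (at x within {-1..1})"
      "(g has_vector_derivative deriv_I g x) (at x within {-1..1})"
      using assms by (auto simp: deriv_I_def differentiable_on_def vector_derivative_works)
    then have "((\<lambda>x. a *\<^sub>R f x + b *\<^sub>R g x) has_vector_derivative
        a *\<^sub>R deriv_I f x + b *\<^sub>R deriv_I g x) (at x within {-1..1})"
      by (auto intro!: derivative_eq_intros simp: algebra_simps)
    moreover have "(\<lambda>x. a *\<^sub>R f x + b *\<^sub>R g x) = a *\<^sub>R f + b *\<^sub>R g"
      by (simp add: fun_eq_iff)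
    ultimately have "((a *\<^sub>R f + b *\<^sub>R g) has_vector_derivative
        a *\<^sub>R deriv_I f x + b *\<^sub>R deriv_I g x) (at x within {-1..1})"
      by simp
    then have "vector_derivative (a *\<^sub>R f + b *\<^sub>R g) (at x within {-1..1}) =
        a *\<^sub>R deriv_I f x + b *\<^sub>R deriv_I g x"
      using True by (intro vector_derivative_within_cbox[of "-1" 1 x, simplified box_real]) auto
    then show ?thesis
      using True by (simp add: deriv_I_def)
  qed (auto simp: deriv_I_def)
qed

lemma deriv_I_funpow_lincomb:
  assumes "\<forall>j<r. (deriv_I ^^ j) f differentiable_on {-1..1}"
    "\<forall>j<r. (deriv_I ^^ j) g differentiable_on {-1..1}"
  shows "(deriv_I ^^ r) (a *\<^sub>R f + b *\<^sub>R g) = a *\<^sub>R (deriv_I ^^ r) f + b *\<^sub>R (deriv_I ^^ r) g"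
  using assms by (induction r) (auto simp: deriv_I_lincomb)

lemma differentiable_on_lincomb:
  fixes f g :: "real \<Rightarrow> real"
  assumes "f differentiable_on S" "g differentiable_on S"
  shows "(a *\<^sub>R f + b *\<^sub>R g) differentiable_on S"
proof -
  have "(\<lambda>x. a * f x + b * g x) differentiable_on S"
    using assms by (intro derivative_intros) auto
  moreover have "(\<lambda>x. a * f x + b * g x) = a *\<^sub>R f + b *\<^sub>R g"
    by (simp add: fun_eq_iff)
  ultimately show ?thesis by simp
qed

lemma holder_space_deriv_lincomb:
  assumes "f \<in> holder_space k \<beta>" "g \<in> holder_space k \<beta>" "r \<le> k"
  shows "(deriv_I ^^ r) (a *\<^sub>R f + b *\<^sub>R g) = a *\<^sub>R (deriv_I ^^ r) f + b *\<^sub>R (deriv_I ^^ r) g"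
  using assms by (intro deriv_I_funpow_lincomb) (auto simp: holder_space_def)

lemma holder_space_lincomb:
  assumes f: "f \<in> holder_space k \<beta>" and g: "g \<in> holder_space k \<beta>"
  shows "a *\<^sub>R f + b *\<^sub>R g \<in> holder_space k \<beta>"
proof -
  obtain C where C: "\<And>x y. x \<in> {-1..1} \<Longrightarrow> y \<in> {-1..1} \<Longrightarrow>
      \<bar>(deriv_I ^^ k) f x - (deriv_I ^^ k) f y\<bar> \<le> C * \<bar>x - y\<bar> powr \<beta>"
    using f unfolding holder_space_def by blast
  obtain C' where C': "\<And>x y. x \<in> {-1..1} \<Longrightarrow> y \<in> {-1..1} \<Longrightarrow>
      \<bar>(deriv_I ^^ k) g x - (deriv_I ^^ k) g y\<bar> \<le> C' * \<bar>x - y\<bar> powr \<beta>"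
    using g unfolding holder_space_def by blast
  have "\<bar>(deriv_I ^^ k) (a *\<^sub>R f + b *\<^sub>R g) x - (deriv_I ^^ k) (a *\<^sub>R f + b *\<^sub>R g) y\<bar>
      \<le> (\<bar>a\<bar> * C + \<bar>b\<bar> * C') * \<bar>x - y\<bar> powr \<beta>" if "x \<in> {-1..1}" "y \<in> {-1..1}" for x y
  proof -
    have "\<bar>(deriv_I ^^ k) (a *\<^sub>R f + b *\<^sub>R g) x - (deriv_I ^^ k) (a *\<^sub>R f + b *\<^sub>R g) y\<bar>
        = \<bar>a * ((deriv_I ^^ k) f x - (deriv_I ^^ k) f y) +
           b * ((deriv_I ^^ k) g x - (deriv_I ^^ k) g y)\<bar>"
      by (simp add: holder_space_deriv_lincomb[OF f g] algebra_simps)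
    also have "\<dots> \<le> \<bar>a\<bar> * \<bar>(deriv_I ^^ k) f x - (deriv_I ^^ k) f y\<bar> +
        \<bar>b\<bar> * \<bar>(deriv_I ^^ k) g x - (deriv_I ^^ k) g y\<bar>"
      by (metis abs_mult abs_triangle_ineq)
    also have "\<dots> \<le> \<bar>a\<bar> * (C * \<bar>x - y\<bar> powr \<beta>) + \<bar>b\<bar> * (C' * \<bar>x - y\<bar> powr \<beta>)"
      using C[OF that] C'[OF that] by (intro add_mono mult_left_mono) auto
    finally show ?thesis by (simp add: algebra_simps)
  qed
  moreover have "(deriv_I ^^ r) (a *\<^sub>R f + b *\<^sub>R g) differentiable_on {-1..1}" if "r < k" for r
    using f g that
    by (auto simp: holder_space_deriv_lincomb[OF f g] holder_space_def intro!: differentiable_on_lincomb)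
  moreover have "(a *\<^sub>R f + b *\<^sub>R g) x = 0" if "x \<notin> {-1..1}" for x
    using f g that by (simp add: holder_space_def)
  ultimately show ?thesis
    unfolding holder_space_def by blast
qed

lemma deriv_I_funpow_zero: "(deriv_I ^^ r) 0 = 0"
proof (induction r)
  case (Suc r)
  have "deriv_I (0 *\<^sub>R (\<lambda>_. 0) + 0 *\<^sub>R (\<lambda>_. 0)) = 0 *\<^sub>R deriv_I (\<lambda>_. 0) + 0 *\<^sub>R deriv_I (\<lambda>_. 0)"
    by (rule deriv_I_lincomb) auto
  then have "deriv_I 0 = 0"
    by (simp only: scaleR_zero_left add_0)
  then show ?case by (simp only: funpow.simps o_apply Suc.IH)
qed auto

lemma subspace_holder_space: "subspace (holder_space k \<beta>)"
proof (rule subspaceI)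
  show "0 \<in> holder_space k \<beta>"
    by (auto simp: holder_space_def deriv_I_funpow_zero intro: exI[of _ 0])
      (simp add: zero_fun_def)
  show "f + g \<in> holder_space k \<beta>" if "f \<in> holder_space k \<beta>" "g \<in> holder_space k \<beta>" for f g
    using holder_space_lincomb[OF that, of 1 1] by simp
  show "c *\<^sub>R f \<in> holder_space k \<beta>" if "f \<in> holder_space k \<beta>" for c f
    using holder_space_lincomb[OF that that, of c 0] by simp
qed

lemma holder_space_deriv_bounded:
  assumes f: "f \<in> holder_space k \<beta>" and \<beta>: "0 < \<beta>" and r: "r \<le> k"
  shows "bdd_above ((\<lambda>x. \<bar>(deriv_I ^^ r) f x\<bar>) ` {-1..1})"
proof (cases "r < k")
  case True
  then have "(deriv_I ^^ r) f differentiable_on {-1..1}"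
    using f by (simp add: holder_space_def)
  then have "compact ((\<lambda>x. \<bar>(deriv_I ^^ r) f x\<bar>) ` {-1..1})"
    by (intro compact_continuous_image continuous_intros differentiable_imp_continuous_on) auto
  then show ?thesis
    by (intro bounded_imp_bdd_above compact_imp_bounded)
next
  case False
  with r have [simp]: "r = k" by simp
  obtain C where C: "\<And>x y. x \<in> {-1..1} \<Longrightarrow> y \<in> {-1..1} \<Longrightarrow>
      \<bar>(deriv_I ^^ k) f x - (deriv_I ^^ k) f y\<bar> \<le> C * \<bar>x - y\<bar> powr \<beta>"
    using f unfolding holder_space_def by blast
  have "\<bar>(deriv_I ^^ k) f x\<bar> \<le> \<bar>(deriv_I ^^ k) f 0\<bar> + \<bar>C\<bar>" if "x \<in> {-1..1}" for x
  proof -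
    have "C * \<bar>x\<bar> powr \<beta> \<le> \<bar>C\<bar> * 1"
      using that \<beta> by (intro mult_mono powr_le1) auto
    then show ?thesis using C[OF that, of 0] by auto
  qed
  then show ?thesis
    by (intro bdd_aboveI2[where M = "\<bar>(deriv_I ^^ k) f 0\<bar> + \<bar>C\<bar>"]) simp
qed

lemma holder_space_quotient_bounded:
  assumes f: "f \<in> holder_space k \<beta>"
  shows "bdd_above ((\<lambda>(x, y). \<bar>(deriv_I ^^ k) f x - (deriv_I ^^ k) f y\<bar> / \<bar>x - y\<bar> powr \<beta>) `
    {(x, y). x \<in> {-1..1} \<and> y \<in> {-1..1} \<and> x \<noteq> y})"
proof -
  obtain C where C: "\<And>x y. x \<in> {-1..1} \<Longrightarrow> y \<in> {-1..1} \<Longrightarrow>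
      \<bar>(deriv_I ^^ k) f x - (deriv_I ^^ k) f y\<bar> \<le> C * \<bar>x - y\<bar> powr \<beta>"
    using f unfolding holder_space_def by blast
  then show ?thesis
    by (intro bdd_aboveI2[where M = C]) (auto simp: field_simps)
qed

lemma abs_le_holder_norm:
  assumes f: "f \<in> holder_space k \<beta>" and \<beta>: "0 < \<beta>"
  shows "\<bar>f x\<bar> \<le> holder_norm k \<beta> f"
proof -
  let ?s = "\<lambda>r. SUP x\<in>{-1..1}. \<bar>(deriv_I ^^ r) f x\<bar>"
  have q: "0 \<le> (SUP (x, y)\<in>{(x, y). x \<in> {-1..1} \<and> y \<in> {-1..1} \<and> x \<noteq> y}.
      \<bar>(deriv_I ^^ k) f x - (deriv_I ^^ k) f y\<bar> / \<bar>x - y\<bar> powr \<beta>)"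
    by (rule cSUP_upper2[OF holder_space_quotient_bounded[OF f], of "(0, 1)"]) auto
  have m: "?s 0 \<le> (MAX r\<in>{..k}. ?s r)"
    by (intro Max_ge imageI) auto
  have s: "\<bar>f x\<bar> \<le> ?s 0" if "x \<in> {-1..1}" for x
    using cSUP_upper[OF that holder_space_deriv_bounded[OF f \<beta>, of 0]] by simp
  show ?thesis
  proof (cases "x \<in> {-1..1}")
    case True
    then show ?thesis using q m s[of x] by (simp add: holder_norm_def)
  next
    case False
    then have "f x = 0" using f by (auto simp: holder_space_def)
    then show ?thesis using q m s[of 0] abs_ge_zero[of "f 0"] by (simp add: holder_norm_def)
  qed
qed

lemma holder_norm_minus:
  assumes f: "f \<in> holder_space k \<beta>"
  shows "holder_norm k \<beta> (- f) = holder_norm k \<beta> f"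
proof -
  have d: "(deriv_I ^^ r) (- f) x = - (deriv_I ^^ r) f x" if "r \<le> k" for r x
    using holder_space_deriv_lincomb[OF f f that, of "-1" 0] by simp
  have "(SUP x\<in>{-1..1}. \<bar>(deriv_I ^^ r) (- f) x\<bar>) = (SUP x\<in>{-1..1}. \<bar>(deriv_I ^^ r) f x\<bar>)"
    if "r \<le> k" for r using that by (simp add: d)
  then have "(\<lambda>r. SUP x\<in>{-1..1}. \<bar>(deriv_I ^^ r) (- f) x\<bar>) ` {..k} =
      (\<lambda>r. SUP x\<in>{-1..1}. \<bar>(deriv_I ^^ r) f x\<bar>) ` {..k}"
    by (intro image_cong) auto
  then show ?thesis
    by (simp add: holder_norm_def d abs_minus_commute)
qed

lemma holder_norm_triangle:
  assumes f: "f \<in> holder_space k \<beta>" and g: "g \<in> holder_space k \<beta>" and \<beta>: "0 < \<beta>"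
  shows "holder_norm k \<beta> (f + g) \<le> holder_norm k \<beta> f + holder_norm k \<beta> g"
proof -
  have d: "(deriv_I ^^ r) (f + g) x = (deriv_I ^^ r) f x + (deriv_I ^^ r) g x" if "r \<le> k" for r x
    using holder_space_deriv_lincomb[OF f g that, of 1 1] by simp
  let ?s = "\<lambda>f r. SUP x\<in>{-1..1}. \<bar>(deriv_I ^^ r) f x\<bar>"
  let ?S = "{(x, y). x \<in> {-1..1} \<and> y \<in> {-1..1} \<and> x \<noteq> y} :: (real \<times> real) set"
  let ?q = "\<lambda>f (x, y). \<bar>(deriv_I ^^ k) f x - (deriv_I ^^ k) f y\<bar> / \<bar>x - y\<bar> powr \<beta>"
  have "?s (f + g) r \<le> (MAX r\<in>{..k}. ?s f r) + (MAX r\<in>{..k}. ?s g r)" if r: "r \<le> k" for r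
  proof (rule cSUP_least)
    fix x :: real assume x: "x \<in> {-1..1}"
    have "\<bar>(deriv_I ^^ r) f x\<bar> \<le> (MAX r\<in>{..k}. ?s f r)"
      "\<bar>(deriv_I ^^ r) g x\<bar> \<le> (MAX r\<in>{..k}. ?s g r)"
      using r by (intro order_trans[OF cSUP_upper[OF x holder_space_deriv_bounded[OF _ \<beta> r]] Max_ge];
          use f g in auto)+
    then show "\<bar>(deriv_I ^^ r) (f + g) x\<bar> \<le> (MAX r\<in>{..k}. ?s f r) + (MAX r\<in>{..k}. ?s g r)"
      using abs_triangle_ineq[of "(deriv_I ^^ r) f x" "(deriv_I ^^ r) g x"] by (simp add: d[OF r])
  qed auto
  then have "(MAX r\<in>{..k}. ?s (f + g) r) \<le> (MAX r\<in>{..k}. ?s f r) + (MAX r\<in>{..k}. ?s g r)"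
    by (subst Max_le_iff) auto
  moreover have "(SUP z\<in>?S. ?q (f + g) z) \<le> (SUP z\<in>?S. ?q f z) + (SUP z\<in>?S. ?q g z)"
  proof (rule cSUP_least)
    have "(0, 1) \<in> ?S" by simp
    then show "?S \<noteq> {}" by blast
    fix z assume z: "z \<in> ?S"
    have "?q f z \<le> (SUP z\<in>?S. ?q f z)" "?q g z \<le> (SUP z\<in>?S. ?q g z)"
      using cSUP_upper[OF z holder_space_quotient_bounded[OF f]]
        cSUP_upper[OF z holder_space_quotient_bounded[OF g]] by auto
    moreover have "?q (f + g) z \<le> ?q f z + ?q g z"
    proof -
      obtain x y where [simp]: "z = (x, y)" by fastforce
      have "\<bar>(deriv_I ^^ k) (f + g) x - (deriv_I ^^ k) (f + g) y\<bar> \<le>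
          \<bar>(deriv_I ^^ k) f x - (deriv_I ^^ k) f y\<bar> + \<bar>(deriv_I ^^ k) g x - (deriv_I ^^ k) g y\<bar>"
        by (simp add: d)
      then show ?thesis by (simp add: divide_right_mono flip: add_divide_distrib)
    qed
    ultimately show "?q (f + g) z \<le> (SUP z\<in>?S. ?q f z) + (SUP z\<in>?S. ?q g z)" by linarith
  qed
  ultimately show ?thesis unfolding holder_norm_def by linarith
qed


section \<open>Normed spaces given by a carrier and a norm\<close>

text \<open>
  Since the Hoelder spaces depend on numerical parameters, a normed space is given by a linear
  subspace X of a vector space together with a norm n on X. The distance is cut off outside X
  because the locale \<^locale>\<open>Metric_space\<close> asks for nonnegativity and symmetry
  on the whole type.
\<close>

definition norm_dist :: "'a::real_vector set \<Rightarrow> ('a \<Rightarrow> real) \<Rightarrow> 'a \<Rightarrow> 'a \<Rightarrow> real" where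
  "norm_dist X n = (\<lambda>x y. if x \<in> X \<and> y \<in> X then n (x - y) else 0)"

lemma Metric_space_holder:
  assumes "0 < \<beta>"
  shows "Metric_space (holder_space k \<beta>) (norm_dist (holder_space k \<beta>) (holder_norm k \<beta>))"
proof
  let ?X = "holder_space k \<beta>" and ?d = "norm_dist (holder_space k \<beta>) (holder_norm k \<beta>)"
  note diff = subspace_diff[OF subspace_holder_space[of k \<beta>]]
  have pos: "\<bar>(f - g) x\<bar> \<le> ?d f g" if "f \<in> ?X" "g \<in> ?X" for f g x
    using abs_le_holder_norm[OF diff[OF that] assms] that by (simp add: norm_dist_def)
  show "0 \<le> ?d f g" for f g
    using pos[of f g 0] by (cases "f \<in> ?X \<and> g \<in> ?X") (auto simp: norm_dist_def)
  show "?d f g = ?d g f" for f g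
    using holder_norm_minus[OF diff, of f g] by (auto simp: norm_dist_def)
  show "?d f g = 0 \<longleftrightarrow> f = g" if "f \<in> ?X" "g \<in> ?X" for f g
  proof
    assume "?d f g = 0"
    then show "f = g" using pos[OF that] by (auto simp: fun_eq_iff)
  next
    assume eq: "f = g"
    have "(0, 1) \<in> {(x, y). x \<in> {-1..1} \<and> y \<in> {-1..1} \<and> x \<noteq> (y::real)}"
      by simp
    then have "{(x, y). x \<in> {-1..1} \<and> y \<in> {-1..1} \<and> x \<noteq> (y::real)} \<noteq> {}"
      by blast
    then show "?d f g = 0"
      unfolding eq norm_dist_def holder_norm_def
      by (simp add: deriv_I_funpow_zero case_prod_unfold del: atLeastAtMost_iff)
  qed
  show "?d f h \<le> ?d f g + ?d g h" if "f \<in> ?X" "g \<in> ?X" "h \<in> ?X" for f g h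
    using holder_norm_triangle[OF diff diff assms, of f g g h] that by (simp add: norm_dist_def)
qed

abbreviation norm_topology :: "'a::real_vector set \<Rightarrow> ('a \<Rightarrow> real) \<Rightarrow> 'a topology" where
  "norm_topology X n \<equiv> Metric_space.mtopology X (norm_dist X n)"

abbreviation norm_bounded :: "'a::real_vector set \<Rightarrow> ('a \<Rightarrow> real) \<Rightarrow> 'a set \<Rightarrow> bool" where
  "norm_bounded X n \<equiv> Metric_space.mbounded X (norm_dist X n)"

abbreviation norm_cball :: "'a::real_vector set \<Rightarrow> ('a \<Rightarrow> real) \<Rightarrow> 'a \<Rightarrow> real \<Rightarrow> 'a set" where
  "norm_cball X n \<equiv> Metric_space.mcball X (norm_dist X n)"

definition closed_domain :: "'a::real_vector set \<Rightarrow> ('a \<Rightarrow> real) \<Rightarrow> 'a set \<Rightarrow> bool" where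
  "closed_domain X n D \<longleftrightarrow>
     (\<exists>\<Omega>. openin (norm_topology X n) \<Omega> \<and> connectedin (norm_topology X n) \<Omega> \<and> \<Omega> \<noteq> {} \<and>
          D = norm_topology X n closure_of \<Omega>)"

definition closed_linear_hull :: "'a::real_vector set \<Rightarrow> ('a \<Rightarrow> real) \<Rightarrow> 'a set \<Rightarrow> 'a set" where
  "closed_linear_hull X n S =
     \<Inter>{V. subspace V \<and> closedin (norm_topology X n) V \<and> S \<subseteq> V}"

definition completely_continuous ::
    "'a::real_vector set \<Rightarrow> ('a \<Rightarrow> real) \<Rightarrow> ('a \<Rightarrow> 'a) \<Rightarrow> bool" where
  "completely_continuous X n F \<longleftrightarrow>
     continuous_map (norm_topology X n) (norm_topology X n) F \<and>
     (\<forall>B. norm_bounded X n B \<longrightarrow>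
        compactin (norm_topology X n) (norm_topology X n closure_of (F ` B)))"

definition bounded_linear_on ::
    "'a::real_vector set \<Rightarrow> ('a \<Rightarrow> real) \<Rightarrow> ('a \<Rightarrow> 'a) \<Rightarrow> bool" where
  "bounded_linear_on X n A \<longleftrightarrow>
     A \<in> X \<rightarrow> X \<and>
     (\<forall>x\<in>X. \<forall>y\<in>X. A (x + y) = A x + A y) \<and>
     (\<forall>c. \<forall>x\<in>X. A (c *\<^sub>R x) = c *\<^sub>R A x) \<and>
     (\<exists>C. \<forall>x\<in>X. n (A x) \<le> C * n x)"

definition has_frechet_derivative ::
    "'a::real_vector set \<Rightarrow> ('a \<Rightarrow> real) \<Rightarrow> ('a \<Rightarrow> 'a) \<Rightarrow> ('a \<Rightarrow> 'a) \<Rightarrow> 'a \<Rightarrow> bool" where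
  "has_frechet_derivative X n F A y \<longleftrightarrow>
     bounded_linear_on X n A \<and>
     (\<forall>e>0. \<exists>d>0. \<forall>h\<in>X. n h < d \<longrightarrow> n (F (y + h) - F y - A h) \<le> e * n h)"

definition eigenvalue_on :: "'a::real_vector set \<Rightarrow> ('a \<Rightarrow> 'a) \<Rightarrow> real \<Rightarrow> bool" where
  "eigenvalue_on X A c \<longleftrightarrow> (\<exists>h\<in>X. h \<noteq> 0 \<and> A h = c *\<^sub>R h)"


section \<open>The Leray-Schauder fixed point index\<close>

text \<open>
  Let E be the span of the independent vectors b 0, ..., b m, let u lie in E and let G map the
  closed ball of radius r about u into E. The Brouwer degree of y - G y at 0 on the ball of E of
  radius r about u is the degree of the self-map of the Euclidean unit sphere obtained by
  radially projecting the sphere (read in the coordinates b) onto the boundary of that ball,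
  applying y - G y, and normalising the coordinate vector of the result.
\<close>

definition finite_dim_degree ::
    "('a::real_vector \<Rightarrow> real) \<Rightarrow> 'a \<Rightarrow> real \<Rightarrow> nat \<Rightarrow> (nat \<Rightarrow> 'a) \<Rightarrow> ('a \<Rightarrow> 'a) \<Rightarrow> int" where
  "finite_dim_degree n u r m b G =
     Brouwer_degree2 m (\<lambda>x.
       let v = (\<Sum>i\<le>m. x i *\<^sub>R b i);
           y = u + (r / n v) *\<^sub>R v;
           w = (\<lambda>i. if i \<le> m then representation (b ` {..m}) (y - G y) (b i) else 0)
       in (\<lambda>i. w i / sqrt (\<Sum>j\<le>m. (w j)\<^sup>2)))"

text \<open>
  Admissible finite-dimensional approximations of F on the ball: G is closer to F on the
  ball than F is to having a fixed point on the boundary.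
\<close>

definition ls_approximation ::
    "'a::real_vector set \<Rightarrow> ('a \<Rightarrow> real) \<Rightarrow> ('a \<Rightarrow> 'a) \<Rightarrow> 'a \<Rightarrow> real \<Rightarrow>
       nat \<Rightarrow> (nat \<Rightarrow> 'a) \<Rightarrow> ('a \<Rightarrow> 'a) \<Rightarrow> bool" where
  "ls_approximation X n F u r m b G \<longleftrightarrow>
     inj_on b {..m} \<and> independent (b ` {..m}) \<and> b ` {..m} \<subseteq> X \<and> u \<in> span (b ` {..m}) \<and>
     G ` norm_cball X n u r \<subseteq> span (b ` {..m}) \<and>
     continuous_map (subtopology (norm_topology X n) (norm_cball X n u r)) (norm_topology X n) G \<and>
     (\<exists>e. (\<forall>y\<in>norm_cball X n u r. n (F y - G y) \<le> e) \<and>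
          e < (INF y\<in>{y \<in> X. n (y - u) = r}. n (y - F y)))"

definition ls_degree ::
    "'a::real_vector set \<Rightarrow> ('a \<Rightarrow> real) \<Rightarrow> ('a \<Rightarrow> 'a) \<Rightarrow> 'a \<Rightarrow> real \<Rightarrow> int" where
  "ls_degree X n F u r =
     (THE d. \<exists>m b G. ls_approximation X n F u r m b G \<and> d = finite_dim_degree n u r m b G)"

definition ls_index ::
    "'a::real_vector set \<Rightarrow> ('a \<Rightarrow> real) \<Rightarrow> ('a \<Rightarrow> 'a) \<Rightarrow> 'a \<Rightarrow> int" where
  "ls_index X n F u = (THE d. \<forall>\<^sub>F r in at_right 0. ls_degree X n F u r = d)"

definition isolated_fixed_point ::
    "'a::real_vector set \<Rightarrow> ('a \<Rightarrow> real) \<Rightarrow> ('a \<Rightarrow> 'a) \<Rightarrow> 'a \<Rightarrow> bool" where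
  "isolated_fixed_point X n F u \<longleftrightarrow>
     u \<in> X \<and> F u = u \<and> (\<exists>r>0. \<forall>y\<in>X. n (y - u) < r \<and> F y = y \<longrightarrow> y = u)"


section \<open>Integral operators and the Chebyshev projection\<close>

definition integral_operator :: "(real \<Rightarrow> real) set \<Rightarrow> ((real \<Rightarrow> real) \<Rightarrow> real \<Rightarrow> real) \<Rightarrow> bool" where
  "integral_operator X T \<longleftrightarrow>
     (\<exists>(K :: real \<Rightarrow> real \<Rightarrow> real \<Rightarrow> real) \<alpha>. (\<alpha> = (\<lambda>t. 1) \<or> \<alpha> = (\<lambda>t. t)) \<and>
        (\<forall>y\<in>X. \<forall>t\<in>{-1..1}.
           (\<lambda>s. K (y s) t s) absolutely_integrable_on {-1..\<alpha> t} \<and>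
           T y t = integral {-1..\<alpha> t} (\<lambda>s. K (y s) t s)))"

fun cheb :: "nat \<Rightarrow> real \<Rightarrow> real" where
  "cheb 0 x = 1"
| "cheb (Suc 0) x = x"
| "cheb (Suc (Suc j)) x = 2 * x * cheb (Suc j) x - cheb j x"

definition cheb_I :: "nat \<Rightarrow> real \<Rightarrow> real" where
  "cheb_I j = (\<lambda>x. if x \<in> {-1..1} then cheb j x else 0)"

definition cheb_space :: "nat \<Rightarrow> (real \<Rightarrow> real) set" where
  "cheb_space N = span (cheb_I ` {..N})"

definition cheb_coeff :: "(real \<Rightarrow> real) \<Rightarrow> nat \<Rightarrow> real" where
  "cheb_coeff h j =
     (if j = 0 then 1 / pi else 2 / pi) *
     integral {-1..1} (\<lambda>s. h s * cheb j s / sqrt (1 - s\<^sup>2))"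

definition cheb_proj :: "nat \<Rightarrow> (real \<Rightarrow> real) \<Rightarrow> real \<Rightarrow> real" where
  "cheb_proj N h = (\<Sum>j\<le>N. cheb_coeff h j *\<^sub>R cheb_I j)"

end

theory Submission
  imports Defs "HOL-Computational_Algebra.Polynomial"
begin

text \<open>
  Write A for the derivative of T at u. Since A is compact with values in R and 1 is not an
  eigenvalue, a subsequence argument gives c > 0 with \<open>c * nrm h \<le> nrm (h - P\<^sub>N (A h))\<close> for all h in X
  and all large N. Applied to \<open>h = u\<^sub>N - u\<close>, for which \<open>h - P\<^sub>N (A h)\<close> equals \<open>P\<^sub>N u - u\<close> up to a remainder
  small compared with h, this yields both rate estimates. It also makes \<open>h \<mapsto> h - P\<^sub>N (A h)\<close> invertible on
  the space of polynomials of degree at most N, uniformly in N, so that the projected equation becomes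
  a fixed point equation on a small ball about \<open>P\<^sub>N u\<close>, solved by Brouwer's theorem. As the
  dimension varies with N, Brouwer's theorem is derived from the non-contractibility of the sphere.
\<close>

section \<open>Normed subspaces\<close>

text \<open>A contraction argument is out of reach: differentiability at u bounds the remainder
  \<open>T (u + h) - T u - A h\<close> by a small multiple of \<open>nrm h\<close>, but provides no
  small Lipschitz constant for it. A bound on its size is exactly what Brouwer's theorem consumes.
  The other obstacle is that the projections are controlled on R only: uniformly bounded, and
  convergent pointwise. Apart from f, every vector whose projection is estimated must therefore be
  built from elements of R. Values of A are in R, being limits of difference quotients of T, and so
  is the remainder, as long as T maps a whole ball about u into R. As u and f themselves need not
  lie in R, the convergence of \<open>P N u\<close> to u is assembled from that of
  \<open>P N (T u)\<close> and that of \<open>P N f\<close>. Since u is in general no polynomial,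
  the unknown in the existence proof is the deviation v from \<open>P N u\<close>, which stays in
  the polynomial space, while remainders are still measured from u.\<close>

no_notation Exact_Sequence.exact_seq_arrow
  (\<open>(\<open>indent=3 notation=\<open>mixfix exact_seq\<close>\<close>_ / \<longlongrightarrow>\<index> _)\<close> [1000, 60])

text \<open>All axioms are relative to the carrier: off the Hoelder space the suprema in
  \<open>holder_norm\<close> may range over unbounded sets, and then their values mean
  nothing.\<close>

locale normed_subspace =
  fixes X :: "'a::real_vector set" and nrm :: "'a \<Rightarrow> real"
  assumes subspace_carrier: "subspace X"
    and nrm_nonneg: "x \<in> X \<Longrightarrow> 0 \<le> nrm x"
    and nrm_eq_0: "x \<in> X \<Longrightarrow> nrm x = 0 \<Longrightarrow> x = 0"
    and nrm_triangle: "x \<in> X \<Longrightarrow> y \<in> X \<Longrightarrow> nrm (x + y) \<le> nrm x + nrm y"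
    and nrm_scaleR: "x \<in> X \<Longrightarrow> nrm (c *\<^sub>R x) = \<bar>c\<bar> * nrm x"
begin

lemmas carrier_intros =
  subspace_add[OF subspace_carrier] subspace_diff[OF subspace_carrier]
  subspace_scale[OF subspace_carrier] subspace_0[OF subspace_carrier]
  subspace_sum[OF subspace_carrier] subspace_neg[OF subspace_carrier]

lemma nrm_zero [simp]: "nrm 0 = 0"
  using nrm_scaleR[of 0 0] by (simp add: carrier_intros)

lemma nrm_minus: "x \<in> X \<Longrightarrow> nrm (- x) = nrm x"
  using nrm_scaleR[of x "-1"] by simp

lemma nrm_minus_commute: "x \<in> X \<Longrightarrow> y \<in> X \<Longrightarrow> nrm (x - y) = nrm (y - x)"
  using nrm_minus[of "x - y"] by (simp add: carrier_intros)

lemma nrm_pos: "x \<in> X \<Longrightarrow> x \<noteq> 0 \<Longrightarrow> 0 < nrm x"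
  using nrm_nonneg nrm_eq_0 by (metis less_eq_real_def)

lemma nrm_triangle_diff: "x \<in> X \<Longrightarrow> y \<in> X \<Longrightarrow> nrm (x - y) \<le> nrm x + nrm y"
  using nrm_triangle[of x "- y"] by (simp add: nrm_minus carrier_intros)

lemma nrm_triangle_sub: "x \<in> X \<Longrightarrow> y \<in> X \<Longrightarrow> nrm x \<le> nrm y + nrm (x - y)"
  using nrm_triangle[of y "x - y"] by (simp add: carrier_intros)

lemma nrm_triangle_ineq3: "x \<in> X \<Longrightarrow> y \<in> X \<Longrightarrow> \<bar>nrm x - nrm y\<bar> \<le> nrm (x - y)"
  using nrm_triangle_sub[of x y] nrm_triangle_sub[of y x] nrm_minus_commute[of x y] by linarith

text \<open>The metric is literally the one of the definitions, so \<open>mtopology\<close> inside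
  the locale is the \<open>norm_topology X nrm\<close> of the hypotheses.\<close>

sublocale Metric_space X "norm_dist X nrm"
proof
  show "norm_dist X nrm x z \<le> norm_dist X nrm x y + norm_dist X nrm y z"
    if "x \<in> X" "y \<in> X" "z \<in> X" for x y z
    using nrm_triangle[of "x - y" "y - z"] that by (simp add: norm_dist_def carrier_intros)
qed (auto simp: norm_dist_def nrm_nonneg carrier_intros nrm_minus_commute dest!: nrm_eq_0[rotated])

lemma norm_dist_eq: "x \<in> X \<Longrightarrow> y \<in> X \<Longrightarrow> norm_dist X nrm x y = nrm (x - y)"
  by (simp add: norm_dist_def)

lemma limitin_iff_nrm_tendsto:
  "limitin mtopology g l F \<longleftrightarrow>
     l \<in> X \<and> (\<forall>\<^sub>F x in F. g x \<in> X) \<and> ((\<lambda>x. nrm (g x - l)) \<longlongrightarrow> 0) F"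
proof -
  have "eventually (\<lambda>x. g x \<in> X \<and> norm_dist X nrm (g x) l < e) F \<longleftrightarrow>
      eventually (\<lambda>x. g x \<in> X \<and> dist (nrm (g x - l)) 0 < e) F" if "l \<in> X" for e
    using that
    by (intro eventually_cong arg_cong[where f = "\<lambda>P. eventually P F"])
      (auto simp: norm_dist_eq nrm_nonneg carrier_intros fun_eq_iff)
  then show ?thesis
    unfolding limitin_metric tendsto_iff eventually_conj_iff
    by (metis zero_less_one)
qed

text \<open>Reduces continuity to limits of real numbers. The source \<open>Z\<close> is arbitrary
  because three kinds occur: a space of coordinate vectors, a cylinder over a sphere, and balls in
  finite spans.\<close>

lemma continuous_map_mtopology_iff:
  "continuous_map Z mtopology g \<longleftrightarrow>
     (\<forall>x\<in>topspace Z. g x \<in> X \<and> ((\<lambda>y. nrm (g y - g x)) \<longlongrightarrow> 0) (atin Z x))"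
  (is "?lhs \<longleftrightarrow> ?rhs")
proof
  assume ?lhs
  then show ?rhs
    by (auto simp: continuous_map_atin limitin_iff_nrm_tendsto)
next
  assume R: ?rhs
  have "\<forall>\<^sub>F y in atin Z x. g y \<in> X" if "x \<in> topspace Z" for x
    unfolding eventually_atin using R openin_topspace that by blast
  with R show ?lhs
    by (auto simp: continuous_map_atin limitin_iff_nrm_tendsto)
qed

text \<open>A squeeze: the increment of g is dominated by a real majorant \<open>h x\<close> that
  vanishes at x. The rules for sums, multiples and Lipschitz compositions amount to the choice of
  such a majorant.\<close>

lemma continuous_map_mtopologyI:
  assumes "\<And>x. x \<in> topspace Z \<Longrightarrow> g x \<in> X"
    and "\<And>x. x \<in> topspace Z \<Longrightarrow> (h x \<longlongrightarrow> 0) (atin Z x)"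
    and "\<And>x y. x \<in> topspace Z \<Longrightarrow> y \<in> topspace Z \<Longrightarrow> nrm (g y - g x) \<le> h x y"
  shows "continuous_map Z mtopology g"
  unfolding continuous_map_mtopology_iff
proof (intro ballI conjI)
  fix x assume x: "x \<in> topspace Z"
  have ev: "\<forall>\<^sub>F y in atin Z x. y \<in> topspace Z"
    unfolding eventually_atin using openin_topspace x by blast
  show "((\<lambda>y. nrm (g y - g x)) \<longlongrightarrow> 0) (atin Z x)"
  proof (rule tendsto_sandwich[OF _ _ tendsto_const assms(2)[OF x]])
    show "\<forall>\<^sub>F y in atin Z x. 0 \<le> nrm (g y - g x)"
      using ev by eventually_elim (auto intro!: nrm_nonneg carrier_intros assms(1) x)
    show "\<forall>\<^sub>F y in atin Z x. nrm (g y - g x) \<le> h x y"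
      using ev by eventually_elim (auto intro!: assms(3) x)
  qed
qed (rule assms(1))

lemma continuous_map_mtopology_carrier:
  "continuous_map Z mtopology g \<Longrightarrow> x \<in> topspace Z \<Longrightarrow> g x \<in> X"
  by (simp add: continuous_map_mtopology_iff)

lemma continuous_map_nrm:
  assumes "continuous_map Z mtopology g"
  shows "continuous_map Z euclideanreal (\<lambda>x. nrm (g x))"
  unfolding continuous_map_atin
proof
  fix x assume x: "x \<in> topspace Z"
  have gx: "g y \<in> X" if "y \<in> topspace Z" for y
    using continuous_map_mtopology_carrier[OF assms that] .
  have ev: "\<forall>\<^sub>F y in atin Z x. y \<in> topspace Z"
    unfolding eventually_atin using openin_topspace x by blast
  have "((\<lambda>y. nrm (g y) - nrm (g x)) \<longlongrightarrow> 0) (atin Z x)"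
  proof (rule tendsto_rabs_zero_cancel, rule tendsto_sandwich[OF _ _ tendsto_const])
    show "((\<lambda>y. nrm (g y - g x)) \<longlongrightarrow> 0) (atin Z x)"
      using assms x by (simp add: continuous_map_mtopology_iff)
    show "\<forall>\<^sub>F y in atin Z x. \<bar>nrm (g y) - nrm (g x)\<bar> \<le> nrm (g y - g x)"
      using ev by eventually_elim (auto intro!: nrm_triangle_ineq3 gx x)
  qed auto
  then show "limitin euclideanreal (\<lambda>x. nrm (g x)) (nrm (g x)) (atin Z x)"
    by (simp add: LIM_zero_iff)
qed

lemma continuous_map_carrier_add:
  assumes "continuous_map Z mtopology f" "continuous_map Z mtopology g"
  shows "continuous_map Z mtopology (\<lambda>x. f x + g x)"
proof (rule continuous_map_mtopologyI)
  note X = assms[THEN continuous_map_mtopology_carrier]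
  show "f x + g x \<in> X" if "x \<in> topspace Z" for x
    using X that by (simp add: carrier_intros)
  show "((\<lambda>y. nrm (f y - f x) + nrm (g y - g x)) \<longlongrightarrow> 0) (atin Z x)" if "x \<in> topspace Z" for x
    using assms that by (auto simp: continuous_map_mtopology_iff intro!: tendsto_add_zero)
  show "nrm (f y + g y - (f x + g x)) \<le> nrm (f y - f x) + nrm (g y - g x)"
    if "x \<in> topspace Z" "y \<in> topspace Z" for x y
    using nrm_triangle[of "f y - f x" "g y - g x"] X that
    by (simp add: carrier_intros algebra_simps)
qed

lemma continuous_map_carrier_scaleR:
  assumes g: "continuous_map Z euclideanreal g" and f: "continuous_map Z mtopology f"
  shows "continuous_map Z mtopology (\<lambda>x. g x *\<^sub>R f x)"
proof (rule continuous_map_mtopologyI)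
  note X = f[THEN continuous_map_mtopology_carrier]
  show "g x *\<^sub>R f x \<in> X" if "x \<in> topspace Z" for x
    using X[OF that] by (simp add: carrier_intros)
  show "((\<lambda>y. \<bar>g y\<bar> * nrm (f y - f x) + \<bar>g y - g x\<bar> * nrm (f x)) \<longlongrightarrow> 0) (atin Z x)"
    if "x \<in> topspace Z" for x
  proof -
    have "(g \<longlongrightarrow> g x) (atin Z x)"
      using g that by (simp add: continuous_map_atin)
    moreover have "((\<lambda>y. nrm (f y - f x)) \<longlongrightarrow> 0) (atin Z x)"
      using f that by (simp add: continuous_map_mtopology_iff)
    ultimately show ?thesis
      by (auto intro!: tendsto_eq_intros)
  qed
  show "nrm (g y *\<^sub>R f y - g x *\<^sub>R f x) \<le> \<bar>g y\<bar> * nrm (f y - f x) + \<bar>g y - g x\<bar> * nrm (f x)"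
    if "x \<in> topspace Z" "y \<in> topspace Z" for x y
  proof -
    have "g y *\<^sub>R f y - g x *\<^sub>R f x = g y *\<^sub>R (f y - f x) + (g y - g x) *\<^sub>R f x"
      by (simp add: algebra_simps)
    then show ?thesis
      using nrm_triangle[of "g y *\<^sub>R (f y - f x)" "(g y - g x) *\<^sub>R f x"] X that
      by (simp add: carrier_intros nrm_scaleR)
  qed
qed

lemma continuous_map_carrier_diff:
  assumes "continuous_map Z mtopology f" "continuous_map Z mtopology g"
  shows "continuous_map Z mtopology (\<lambda>x. f x - g x)"
  using continuous_map_carrier_add[OF assms(1) continuous_map_carrier_scaleR[OF _ assms(2), of "\<lambda>_. -1"]]
  by simp

lemma continuous_map_carrier_sum:
  assumes "\<And>i. i \<in> I \<Longrightarrow> continuous_map Z mtopology (f i)"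
  shows "continuous_map Z mtopology (\<lambda>x. \<Sum>i\<in>I. f i x)"
  using assms
  by (induction I rule: infinite_finite_induct)
    (auto intro!: continuous_map_carrier_add simp: carrier_intros)

text \<open>The Lipschitz estimate is demanded on S only, because the maps composed later are
  controlled only on part of X: a projection on R, the inverse of a linear map on a finite
  span.\<close>

lemma continuous_map_Lipschitz_compose:
  assumes f: "continuous_map Z mtopology f" "f ` topspace Z \<subseteq> S"
    and G: "G ` S \<subseteq> X" "\<And>x y. x \<in> S \<Longrightarrow> y \<in> S \<Longrightarrow> nrm (G x - G y) \<le> K * nrm (x - y)"
  shows "continuous_map Z mtopology (\<lambda>x. G (f x))"
proof (rule continuous_map_mtopologyI)
  show "G (f x) \<in> X" if "x \<in> topspace Z" for x
    using that f G by auto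
  show "((\<lambda>y. K * nrm (f y - f x)) \<longlongrightarrow> 0) (atin Z x)" if "x \<in> topspace Z" for x
    using f that by (auto simp: continuous_map_mtopology_iff intro!: tendsto_mult_right_zero)
  show "nrm (G (f y) - G (f x)) \<le> K * nrm (f y - f x)" if "x \<in> topspace Z" "y \<in> topspace Z" for x y
    using f(2) that by (intro G(2)) auto
qed

lemma closedin_sequence_limit:
  assumes "closedin mtopology S" "\<And>n. g n \<in> S" "l \<in> X" "(\<lambda>n. nrm (g n - l)) \<longlonglongrightarrow> 0"
  shows "l \<in> S"
proof -
  have "S \<subseteq> X" using assms(1) by (simp add: closedin_metric)
  then have "limitin mtopology g l sequentially"
    using assms by (auto simp: limitin_iff_nrm_tendsto intro!: always_eventually)
  then show ?thesis
    using assms unfolding metric_closedin_iff_sequentially_closed by (metis image_subsetI)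
qed

end

section \<open>Fixed points in finite dimension\<close>

text \<open>A closed part of a product of intervals, hence compact by Tychonoff. The spheres live in
  a space of sequences because their dimension is a number, not a type.\<close>

lemma compact_Euclidean_sphere: "compact {x::nat \<Rightarrow> real. (\<forall>i\<ge>Suc m. x i = 0) \<and> (\<Sum>i\<le>m. (x i)\<^sup>2) = 1}"
  (is "compact ?S")
proof -
  have "compactin (product_topology (\<lambda>_::nat. euclideanreal) UNIV) (PiE UNIV (\<lambda>_. {-1..1}))"
    by (simp only: compactin_PiE) simp
  then have "compact (PiE UNIV (\<lambda>_::nat. {-1..1::real}))"
    unfolding euclidean_product_topology compactin_euclidean_iff .
  moreover have "closed ?S"
  proof -
    have "?S = (\<Inter>i\<in>{Suc m..}. {x. x i = 0}) \<inter> {x. (\<Sum>i\<le>m. (x i)\<^sup>2) = 1}"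
      by auto
    moreover have "closed (\<Inter>i\<in>{Suc m..}. {x::nat \<Rightarrow> real. x i = 0})"
      by (intro closed_INT ballI closed_Collect_eq continuous_on_product_coordinates
          continuous_on_const)
    moreover have "closed {x::nat \<Rightarrow> real. (\<Sum>i\<le>m. (x i)\<^sup>2) = 1}"
      by (rule closed_Collect_eq) (auto intro!: continuous_on_sum continuous_on_power)
    ultimately show ?thesis
      by (simp only: closed_Int)
  qed
  moreover have "?S \<subseteq> PiE UNIV (\<lambda>_. {-1..1})"
  proof
    fix x assume x: "x \<in> ?S"
    have "\<bar>x i\<bar> \<le> 1" for i
    proof (cases "i \<le> m")
      case True
      have "(x i)\<^sup>2 \<le> (\<Sum>i\<le>m. (x i)\<^sup>2)"
        by (rule member_le_sum) (use True in auto)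
      then show ?thesis using x by (simp add: abs_square_le_1)
    next
      case False
      then show ?thesis using x by (simp add: Suc_le_eq)
    qed
    then show "x \<in> PiE UNIV (\<lambda>_. {-1..1})"
      unfolding PiE_iff extensional_UNIV abs_le_iff by (simp add: minus_le_iff)
  qed
  ultimately show ?thesis
    using compact_Int_closed[of "PiE UNIV (\<lambda>_. {-1..1})" ?S] by (simp only: Int_absorb1)
qed

lemma nsphere_eq_top_of_set:
  "nsphere m = top_of_set {x. (\<forall>i\<ge>Suc m. x i = 0) \<and> (\<Sum>i\<le>m. (x i)\<^sup>2) = 1}"
  unfolding nsphere euclidean_product_topology Collect_conj_eq
  by (simp add: Suc_le_eq Int_commute)

lemma not_contractible_Euclidean_sphere:
  "\<not> contractible {x::nat \<Rightarrow> real. (\<forall>i\<ge>Suc m. x i = 0) \<and> (\<Sum>i\<le>m. (x i)\<^sup>2) = 1}"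
  using non_contractible_space_nsphere[of m] by (simp add: nsphere_eq_top_of_set)

text \<open>Without a zero, h could be divided by its length. The start, a positive multiple of x,
  would become x itself and the end a constant, so that the sphere would be contractible.\<close>

lemma Euclidean_homotopy_has_zero:
  fixes h :: "real \<times> (nat \<Rightarrow> real) \<Rightarrow> nat \<Rightarrow> real" and m :: nat
  defines "S \<equiv> {x::nat \<Rightarrow> real. (\<forall>i\<ge>Suc m. x i = 0) \<and> (\<Sum>i\<le>m. (x i)\<^sup>2) = 1}"
  assumes cont: "\<And>i. i \<le> m \<Longrightarrow> continuous_on ({0..1} \<times> S) (\<lambda>p. h p i)"
    and start: "\<And>x i. x \<in> S \<Longrightarrow> i \<le> m \<Longrightarrow> h (0, x) i = c x * x i" "\<And>x. x \<in> S \<Longrightarrow> 0 < c x"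
    and final: "\<And>x i. x \<in> S \<Longrightarrow> i \<le> m \<Longrightarrow> h (1, x) i = a i"
  obtains s x where "s \<in> {0..1}" "x \<in> S" "\<And>i. i \<le> m \<Longrightarrow> h (s, x) i = 0"
proof (rule ccontr)
  assume contra: "\<not> thesis"
  note zero = that
  define l where "l p = sqrt (\<Sum>i\<le>m. (h p i)\<^sup>2)" for p
  have l_pos: "0 < l p" if p: "p \<in> {0..1} \<times> S" for p
  proof -
    obtain s x where [simp]: "p = (s, x)" by fastforce
    obtain i where i: "i \<le> m" "h p i \<noteq> 0"
      using zero[of s x] contra p by auto
    then have "0 < (\<Sum>i\<le>m. (h p i)\<^sup>2)"
      by (intro sum_pos2[of _ i]) auto
    then show ?thesis by (simp add: l_def)
  qed
  \<comment> \<open>Entries beyond m are set to 0 since the sphere demands it and nothing is assumed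
    about h there.\<close>
  define H where "H p i = (if i \<le> m then h p i / l p else 0)" for p i
  have "homotopic_with_canon (\<lambda>_. True) S S id (\<lambda>_. \<lambda>i. if i \<le> m then a i / sqrt (\<Sum>i\<le>m. (a i)\<^sup>2) else 0)"
    unfolding homotopic_with[where P = "\<lambda>_. True", simplified]
  proof (intro exI[of _ H] conjI ballI)
    have "continuous_on ({0..1} \<times> S) (\<lambda>p. H p i)" for i
      unfolding H_def using l_pos
      by (cases "i \<le> m") (force simp: l_def intro!: continuous_intros cont)+
    moreover have "H p \<in> S" if "p \<in> {0..1} \<times> S" for p
    proof -
      have "(\<Sum>i\<le>m. (H p i)\<^sup>2) = (\<Sum>i\<le>m. (h p i)\<^sup>2) / (l p)\<^sup>2"
        by (simp add: H_def power_divide sum_divide_distrib)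
      also have "(l p)\<^sup>2 = (\<Sum>i\<le>m. (h p i)\<^sup>2)"
        by (simp add: l_def sum_nonneg)
      finally show ?thesis
        using l_pos[OF that] by (auto simp: S_def H_def l_def)
    qed
    ultimately show "continuous_map (prod_topology (top_of_set {0..1}) (top_of_set S)) (top_of_set S) H"
      by (auto simp: continuous_map_in_subtopology intro!: continuous_on_coordinatewise_then_product)
    show "H (0, x) = id x" if "x \<in> topspace (top_of_set S)" for x
    proof
      fix i
      have x: "x \<in> S" "(\<Sum>i\<le>m. (x i)\<^sup>2) = 1" using that by (auto simp: S_def)
      have "l (0, x) = sqrt (\<Sum>i\<le>m. (c x * x i)\<^sup>2)"
        unfolding l_def by (intro arg_cong[where f = sqrt] sum.cong) (auto simp: start x)
      also have "\<dots> = c x"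
        using start(2)[OF x(1)] x(2)
        by (simp add: power_mult_distrib real_sqrt_mult flip: sum_distrib_left)
      finally show "H (0, x) i = id x i"
        using start(1)[OF x(1), of i] start(2)[OF x(1)] x(1) by (auto simp: H_def S_def)
    qed
    show "H (1, x) = (\<lambda>i. if i \<le> m then a i / sqrt (\<Sum>i\<le>m. (a i)\<^sup>2) else 0)"
      if "x \<in> topspace (top_of_set S)" for x
      using final that by (auto simp: H_def l_def fun_eq_iff)
  qed
  then have "contractible S"
    by (auto simp: contractible_def)
  then show False
    using not_contractible_Euclidean_sphere[of m] by (simp add: S_def)
qed

section \<open>Coordinates in a finite span and Brouwer's theorem\<close>

context normed_subspace
begin

text \<open>On the compact sphere of coordinate vectors the norm of the combination attains its
  minimum, which independence makes positive. Homogeneity carries the estimate to all coordinate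
  vectors, with K the reciprocal of that minimum.\<close>

lemma coordinates_bounded:
  fixes b :: "nat \<Rightarrow> 'a"
  assumes b: "\<And>i. i \<le> m \<Longrightarrow> b i \<in> X"
    and indep: "\<And>x i. (\<Sum>i\<le>m. x i *\<^sub>R b i) = 0 \<Longrightarrow> i \<le> m \<Longrightarrow> x i = 0"
  obtains K where "K > 0" "\<And>x i. i \<le> m \<Longrightarrow> \<bar>x i\<bar> \<le> K * nrm (\<Sum>i\<le>m. x i *\<^sub>R b i)"
proof -
  define V where "V x = (\<Sum>i\<le>m. x i *\<^sub>R b i)" for x :: "nat \<Rightarrow> real"
  have V: "V x \<in> X" for x
    unfolding V_def by (intro carrier_intros b) simp
  define S :: "(nat \<Rightarrow> real) set" where "S = {x. (\<forall>i\<ge>Suc m. x i = 0) \<and> (\<Sum>i\<le>m. (x i)\<^sup>2) = 1}"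
  have "continuous_map euclidean mtopology V"
    unfolding V_def
    by (intro continuous_map_carrier_sum continuous_map_carrier_scaleR) (auto intro: b)
  then have cont: "continuous_on S (\<lambda>x. nrm (V x))"
    using continuous_map_nrm[of euclidean V] continuous_on_subset by fastforce
  have "(\<lambda>i. if i = 0 then 1 else 0) \<in> S"
    by (auto simp: S_def if_distrib[of "\<lambda>x. x\<^sup>2"] cong: if_cong)
  then obtain x0 where x0: "x0 \<in> S" "\<And>x. x \<in> S \<Longrightarrow> nrm (V x0) \<le> nrm (V x)"
    using continuous_attains_inf[OF compact_Euclidean_sphere[of m, folded S_def] _ cont] by auto
  have "V x0 \<noteq> 0"
    using indep[of x0] x0(1) by (auto simp: V_def S_def)
  then have pos: "0 < nrm (V x0)"
    using nrm_pos V by blast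
  have "\<bar>x i\<bar> \<le> inverse (nrm (V x0)) * nrm (V x)" if i: "i \<le> m" for x i
  proof (cases "x i = 0")
    case True
    then show ?thesis using pos nrm_nonneg[OF V] by simp
  next
    case False
    define l where "l = sqrt (\<Sum>i\<le>m. (x i)\<^sup>2)"
    have le: "(x i)\<^sup>2 \<le> (\<Sum>i\<le>m. (x i)\<^sup>2)"
      using i by (intro member_le_sum) auto
    then have xl: "\<bar>x i\<bar> \<le> l"
      unfolding l_def by (intro real_le_rsqrt) simp
    with False have l: "0 < l" by simp
    define z where "z i = (if i \<le> m then x i / l else 0)" for i
    have "(\<Sum>i\<le>m. (z i)\<^sup>2) = (\<Sum>i\<le>m. (x i)\<^sup>2) / l\<^sup>2"
      by (simp add: z_def power_divide sum_divide_distrib)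
    also have "l\<^sup>2 = (\<Sum>i\<le>m. (x i)\<^sup>2)"
      by (simp add: l_def sum_nonneg)
    finally have "z \<in> S"
      using l by (auto simp: S_def z_def l_def)
    then have "nrm (V x0) \<le> nrm (V z)" by (rule x0)
    also have "V z = (1 / l) *\<^sub>R V x"
      by (simp add: V_def z_def scaleR_sum_right)
    finally have "nrm (V x0) * l \<le> nrm (V x)"
      using l by (simp add: nrm_scaleR V field_simps)
    then show ?thesis
      using pos order_trans[OF mult_left_mono[OF xl, of "nrm (V x0)"]] by (simp add: field_simps)
  qed
  then show thesis
    using that[of "inverse (nrm (V x0))"] pos by (simp add: V_def)
qed

end

lemma independent_coordinates_eq_0:
  assumes "inj_on b {..m::nat}" "independent (b ` {..m})"
    and "(\<Sum>i\<le>m. x i *\<^sub>R b i) = 0" "i \<le> m"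
  shows "x i = 0"
proof -
  define u where "u v = x (the_inv_into {..m} b v)" for v
  have u: "u (b j) = x j" if "j \<le> m" for j
    unfolding u_def using the_inv_into_f_f[OF assms(1), of j] that by simp
  have "(\<Sum>v\<in>b ` {..m}. u v *\<^sub>R v) = (\<Sum>i\<le>m. x i *\<^sub>R b i)"
    using u by (subst sum.reindex[OF assms(1)]) simp
  then have "u (b i) = 0"
    using assms real_vector.independentD[of "b ` {..m}" "b ` {..m}" u "b i"] by auto
  then show ?thesis using u assms by simp
qed

lemma span_finite_coordinates:
  assumes "inj_on b {..m::nat}" "v \<in> span (b ` {..m})"
  obtains x where "v = (\<Sum>i\<le>m. x i *\<^sub>R b i)"
proof -
  obtain u where "v = (\<Sum>w\<in>b ` {..m}. u w *\<^sub>R w)"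
    using assms(2) by (auto simp: span_finite)
  then have "v = (\<Sum>i\<le>m. u (b i) *\<^sub>R b i)"
    by (simp add: sum.reindex[OF assms(1)])
  then show thesis by (rule that)
qed

context normed_subspace
begin

lemma span_subset_carrier: "B \<subseteq> X \<Longrightarrow> span B \<subseteq> X"
  by (simp add: span_minimal subspace_carrier)

text \<open>Coordinates in a basis carry the problem to a sphere. A deformation of the identity into
  the constant \<open>- G 0\<close> must vanish somewhere, and it is arranged so that a zero can
  only be a fixed point of G.\<close>

lemma Brouwer_finite_dim:
  assumes B: "finite B" "B \<subseteq> X" and r: "0 < r"
    and G: "\<And>v. v \<in> span B \<Longrightarrow> nrm v \<le> r \<Longrightarrow> G v \<in> span B \<and> nrm (G v) \<le> r"
    and cont: "continuous_map (subtopology mtopology {v \<in> span B. nrm v \<le> r}) mtopology G"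
  obtains v where "v \<in> span B" "nrm v \<le> r" "G v = v"
proof -
  obtain B' where B': "B' \<subseteq> B" "independent B'" "span B' = span B"
    by (metis maximal_independent_subset span_minimal span_mono subspace_span subset_antisym)
  have fin: "finite B'" using B B' finite_subset by blast
  show thesis
  proof (cases "card B'")
    case 0
    then have "B' = {}" using fin by simp
    then have "span B = {0}" using B' by simp
    then show thesis using that[of 0] G[of 0] r by simp
  next
    \<comment> \<open>With m + 1 basis vectors the coordinate sphere is the m-sphere. The empty
      basis, for which there is no sphere, has been treated apart.\<close>
    case (Suc m)
    obtain b where b: "bij_betw b {..m} B'"
      using ex_bij_betw_nat_finite[OF fin] by (auto simp: Suc lessThan_Suc_atMost atLeast0LessThan)
    then have inj: "inj_on b {..m}" and b_im: "b ` {..m} = B'"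
      by (auto simp: bij_betw_def)
    define E where "E = span B"
    have EX: "E \<subseteq> X"
      unfolding E_def by (rule span_subset_carrier) (rule B)
    have E_sub: "subspace E" unfolding E_def by simp
    note E_intros = subspace_add[OF E_sub] subspace_diff[OF E_sub] subspace_scale[OF E_sub]
      subspace_0[OF E_sub] subspace_sum[OF E_sub]
    define V where "V x = (\<Sum>i\<le>m. x i *\<^sub>R b i)" for x :: "nat \<Rightarrow> real"
    have bE: "b i \<in> E" if "i \<le> m" for i
      using that b_im B' span_base unfolding E_def by blast
    have VE: "V x \<in> E" for x
      unfolding V_def by (intro E_intros bE) simp
    have indep: "x i = 0" if "V x = 0" "i \<le> m" for x i
      using independent_coordinates_eq_0[OF inj, of x i] that B' b_im by (simp add: V_def)
    have bX: "b i \<in> X" if "i \<le> m" for i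
      using bE[OF that] EX by blast
    obtain K where K: "K > 0" "\<And>x i. i \<le> m \<Longrightarrow> \<bar>x i\<bar> \<le> K * nrm (V x)"
      using coordinates_bounded[of m b] bX indep unfolding V_def by blast
    have "\<exists>x. v = V x" if "v \<in> E" for v
      using span_finite_coordinates[OF inj, of v] that B' b_im unfolding E_def V_def by metis
    \<comment> \<open>V does not look beyond index m, so \<open>c v\<close> is arbitrary there; all
      facts about it are restricted to i \<le> m.\<close>
    then obtain c where c: "\<And>v. v \<in> E \<Longrightarrow> V (c v) = v" by metis
    have V_diff: "V (\<lambda>i. x i - y i) = V x - V y" for x y
      by (simp add: V_def algebra_simps sum_subtractf)
    have c_diff: "\<bar>c v i - c w i\<bar> \<le> K * nrm (v - w)" if "v \<in> E" "w \<in> E" "i \<le> m" for v w i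
      using K(2)[OF that(3), of "\<lambda>i. c v i - c w i"] V_diff c that by simp
    have c_V: "c (V x) i = x i" if "i \<le> m" for x i
      using indep[of "\<lambda>i. c (V x) i - x i" i] that by (simp add: V_diff c VE)
    have cont_c: "continuous_map Z euclideanreal (\<lambda>p. c (g p) i)"
      if g: "continuous_map Z mtopology g" "g \<in> topspace Z \<rightarrow> E" and i: "i \<le> m" for Z g i
      unfolding continuous_map_atin
    proof
      fix p assume p: "p \<in> topspace Z"
      have ev: "\<forall>\<^sub>F q in atin Z p. q \<in> topspace Z"
        unfolding eventually_atin using openin_topspace p by blast
      have "((\<lambda>q. c (g q) i - c (g p) i) \<longlongrightarrow> 0) (atin Z p)"
      proof (rule tendsto_rabs_zero_cancel, rule tendsto_sandwich[OF _ _ tendsto_const])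
        show "((\<lambda>q. K * nrm (g q - g p)) \<longlongrightarrow> 0) (atin Z p)"
          using g p by (auto simp: continuous_map_mtopology_iff intro!: tendsto_mult_right_zero)
        show "\<forall>\<^sub>F q in atin Z p. \<bar>c (g q) i - c (g p) i\<bar> \<le> K * nrm (g q - g p)"
          using ev by eventually_elim (use g(2) p i in \<open>auto intro!: c_diff\<close>)
      qed auto
      then show "limitin euclideanreal (\<lambda>q. c (g q) i) (c (g p) i) (atin Z p)"
        by (simp add: LIM_zero_iff)
    qed
    define S :: "(nat \<Rightarrow> real) set" where "S = {x. (\<forall>i\<ge>Suc m. x i = 0) \<and> (\<Sum>i\<le>m. (x i)\<^sup>2) = 1}"
    have V_pos: "0 < nrm (V x)" if "x \<in> S" for x
    proof -
      have "V x \<noteq> 0" using indep[of x] that by (auto simp: S_def)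
      then show ?thesis using nrm_pos VE EX by blast
    qed
    define Y where "Y x = (r / nrm (V x)) *\<^sub>R V x" for x
    have YE: "Y x \<in> E" for x unfolding Y_def by (intro E_intros VE)
    have nrm_Y: "nrm (Y x) = r" if "x \<in> S" for x
      using V_pos[OF that] r nrm_scaleR[of "V x"] VE EX by (auto simp: Y_def subset_iff)
    \<comment> \<open>On the sphere of radius r first \<open>v - b * G v\<close> as b grows from 0 to 1, then \<open>a * v - G (a * v)\<close>
      as a decreases from 1 to 0.\<close>
    define W where "W p = min 1 (2 - 2 * fst p) *\<^sub>R Y (snd p) -
        min 1 (2 * fst p) *\<^sub>R G (min 1 (2 - 2 * fst p) *\<^sub>R Y (snd p))" for p :: "real \<times> (nat \<Rightarrow> real)"
    have a_ball: "min 1 (2 - 2 * s) *\<^sub>R Y x \<in> {v \<in> span B. nrm v \<le> r}"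
      if "s \<in> {0..1}" "x \<in> S" for s x
    proof -
      have "\<bar>min 1 (2 - 2 * s)\<bar> * r \<le> 1 * r"
        using that r by (intro mult_right_mono) auto
      then show ?thesis
        using YE EX that nrm_Y[of x] E_intros(3)[OF YE, of "min 1 (2 - 2 * s)" x]
        by (auto simp: nrm_scaleR E_def subset_iff)
    qed
    have WE: "W p \<in> E" if "p \<in> {0..1} \<times> S" for p
      using that a_ball[of "fst p" "snd p"] G unfolding W_def
      by (intro E_intros YE) (auto simp: E_def)
    let ?Z = "top_of_set ({0..1} \<times> S)"
    have cont_snd: "continuous_map ?Z euclideanreal (\<lambda>p. snd p i)" for i
      unfolding continuous_map_iff_continuous
      by (rule continuous_on_product_then_coordinatewise[where f = snd])
        (rule continuous_on_snd[OF continuous_on_id])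
    have cont_min: "continuous_map ?Z euclideanreal (\<lambda>p. min 1 (2 - 2 * fst p))"
      "continuous_map ?Z euclideanreal (\<lambda>p. min 1 (2 * fst p))"
      unfolding continuous_map_iff_continuous
      by (intro continuous_on_min continuous_on_diff continuous_on_mult continuous_on_const
          continuous_on_fst continuous_on_id)+
    have cont_V: "continuous_map ?Z mtopology (\<lambda>p. V (snd p))"
      unfolding V_def
      by (intro continuous_map_carrier_sum continuous_map_carrier_scaleR cont_snd) (simp add: bX)
    have "continuous_map ?Z euclideanreal (\<lambda>p. r / nrm (V (snd p)))"
      using continuous_map_nrm[OF cont_V] V_pos
      by (intro continuous_map_real_divide) force+
    then have cont_Y: "continuous_map ?Z mtopology (\<lambda>p. Y (snd p))"
      unfolding Y_def by (rule continuous_map_carrier_scaleR) (rule cont_V)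
    have cont_aY: "continuous_map ?Z mtopology (\<lambda>p. min 1 (2 - 2 * fst p) *\<^sub>R Y (snd p))"
      by (rule continuous_map_carrier_scaleR[OF cont_min(1) cont_Y])
    have "continuous_map ?Z mtopology (G \<circ> (\<lambda>p. min 1 (2 - 2 * fst p) *\<^sub>R Y (snd p)))"
      by (rule continuous_map_compose[OF _ cont])
        (use cont_aY a_ball in \<open>auto simp: continuous_map_in_subtopology\<close>)
    then have cont_W: "continuous_map ?Z mtopology W"
      unfolding W_def o_def
      by (intro continuous_map_carrier_diff cont_aY continuous_map_carrier_scaleR cont_min)
    obtain s x where sx: "s \<in> {0..1}" "x \<in> S" "\<And>i. i \<le> m \<Longrightarrow> c (W (s, x)) i = 0"
    \<comment> \<open>At parameter 0 the two \<open>min\<close> factors are 1 and 0 and W is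
      \<open>Y x\<close>, with coordinates \<open>r / nrm (V x)\<close> times x. At parameter 1 they
      are 0 and 1 and W is the constant \<open>- G 0\<close>.\<close>
    proof (rule Euclidean_homotopy_has_zero[of m "\<lambda>p. c (W p)" "\<lambda>x. r / nrm (V x)" "c (- G 0)"])
      show "continuous_on ({0..1} \<times> {x. (\<forall>i\<ge>Suc m. x i = 0) \<and> (\<Sum>i\<le>m. (x i)\<^sup>2) = 1}) (\<lambda>p. c (W p) i)"
        if "i \<le> m" for i
        using cont_c[OF cont_W _ that] WE by (auto simp: S_def)
      fix x :: "nat \<Rightarrow> real" and i
      assume "x \<in> {x. (\<forall>i\<ge>Suc m. x i = 0) \<and> (\<Sum>i\<le>m. (x i)\<^sup>2) = 1}"
      then have x: "x \<in> S" by (simp add: S_def)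
      show "0 < r / nrm (V x)" using r V_pos[OF x] by simp
      have "Y x = V (\<lambda>i. r / nrm (V x) * x i)"
        by (simp add: Y_def V_def scaleR_sum_right)
      then show "c (W (0, x)) i = r / nrm (V x) * x i" if "i \<le> m"
        using c_V[OF that] by (simp add: W_def)
      show "c (W (1, x)) i = c (- G 0) i" by (simp add: W_def)
    qed (auto simp: S_def)
    have "W (s, x) = V (c (W (s, x)))"
      using c WE sx by simp
    also have "\<dots> = 0"
      by (simp add: V_def sx)
    finally have W0: "min 1 (2 - 2 * s) *\<^sub>R Y x = min 1 (2 * s) *\<^sub>R G (min 1 (2 - 2 * s) *\<^sub>R Y x)"
      by (simp add: W_def)
    show thesis
    \<comment> \<open>In the first phase a zero would give \<open>Y x\<close> of norm r as a
      multiple of a vector of norm at most r with a factor below 1, which is absurd. In the second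
      phase the factor in front of G is 1, and the zero is a fixed point.\<close>
    proof (cases "2 * s < 1")
      case True
      then have eq: "Y x = (2 * s) *\<^sub>R G (Y x)" using W0 by (simp add: min_def)
      have GY: "G (Y x) \<in> X" "nrm (G (Y x)) \<le> r"
        using G[of "Y x"] YE[of x] nrm_Y[OF sx(2)] EX by (auto simp: E_def)
      have "r = 2 * s * nrm (G (Y x))"
        using nrm_Y[OF sx(2)] sx(1) by (subst (asm) eq) (simp add: nrm_scaleR GY)
      also have "\<dots> \<le> 2 * s * r"
        using GY sx by (intro mult_left_mono) auto
      also have "\<dots> < r" using True r by simp
      finally show thesis by simp
    next
      case False
      then show thesis
        using W0 a_ball[OF sx(1,2)] that[of "min 1 (2 - 2 * s) *\<^sub>R Y x"] by simp
    qed
  qed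
qed

end

text \<open>A is assumed linear on the span only, so a globally linear g with the same values on a
  basis takes its place. Surjectivity is then a count: g sends the basis to equally many independent
  vectors of the span, and a vector outside their span would be one too many.\<close>

lemma injective_on_finite_span_imp_surjective:
  fixes A :: "'a::real_vector \<Rightarrow> 'a"
  assumes fin: "finite B"
    and add: "\<And>x y. x \<in> span B \<Longrightarrow> y \<in> span B \<Longrightarrow> A (x + y) = A x + A y"
    and scale: "\<And>c x. x \<in> span B \<Longrightarrow> A (c *\<^sub>R x) = c *\<^sub>R A x"
    and into: "A ` span B \<subseteq> span B"
    and inj: "\<And>x. x \<in> span B \<Longrightarrow> A x = 0 \<Longrightarrow> x = 0"
  shows "A ` span B = span B"
proof (rule antisym[OF into], rule subsetI)
  fix v assume v: "v \<in> span B"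
  obtain B' where B': "B' \<subseteq> B" "independent B'" "span B' = span B"
    by (metis maximal_independent_subset span_minimal span_mono subspace_span subset_antisym)
  have fin': "finite B'" using fin B' finite_subset by blast
  obtain g where g: "linear g" "\<And>x. x \<in> B' \<Longrightarrow> g x = A x"
    using linear_independent_extend[OF B'(2), of A] by auto
  have gA: "x \<in> span B \<and> g x = A x" if "x \<in> span B'" for x
    using that
  proof (induction rule: span_induct_alt)
    case base
    show ?case using scale[of 0 0] linear_0[OF g(1)] by (simp add: span_0)
  next
    case (step c x y)
    have x: "x \<in> span B" using step B' span_base by blast
    show ?case
      using x step g by (simp add: linear_add linear_scale add scale span_add span_scale)
  qed
  have injg: "inj_on g (span B')"
  proof (rule inj_onI)
    fix x y assume xy: "x \<in> span B'" "y \<in> span B'" "g x = g y"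
    then have "g (x - y) = 0" by (simp add: linear_diff g)
    moreover have d: "x - y \<in> span B'" using xy by (simp add: span_diff)
    ultimately have "x - y = 0" using inj[of "x - y"] gA[OF d] by simp
    then show "x = y" by simp
  qed
  have ind: "independent (g ` B')"
    using linear_independent_injective_image[OF g(1) B'(2) injg] .
  have card: "card (g ` B') = card B'"
    by (rule card_image[OF inj_on_subset[OF injg span_superset]])
  have sub: "g ` B' \<subseteq> span B'"
  proof
    fix y assume "y \<in> g ` B'"
    then obtain x where "x \<in> B'" "y = g x" by auto
    then have "x \<in> span B" "y = A x" using gA[of x] by (simp_all add: span_base)
    then show "y \<in> span B'" using into B'(3) by auto
  qed
  have "v \<in> span (g ` B')"
  proof (rule ccontr)
    assume nv: "v \<notin> span (g ` B')"
    then have "independent (insert v (g ` B'))"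
      using ind by (rule independent_insertI)
    moreover have "insert v (g ` B') \<subseteq> span B'"
      using sub v B'(3) by simp
    ultimately have "card (insert v (g ` B')) \<le> card B'"
      by (rule independent_span_bound[OF fin', THEN conjunct2])
    moreover have "v \<notin> g ` B'" using nv span_superset[of "g ` B'"] by (rule contra_subsetD[rotated])
    then have "card (insert v (g ` B')) = Suc (card (g ` B'))"
      by (intro card_insert_disjoint finite_imageI fin')
    ultimately show False using card by linarith
  qed
  then have "v \<in> g ` span B'"
    by (simp only: linear_span_image[OF g(1)])
  then obtain x where "x \<in> span B'" "v = g x" by auto
  then show "v \<in> A ` span B" using gA[of x] by simp
qed

context normed_subspace
begin

text \<open>The lower bound makes A invertible on the span, with an inverse J of Lipschitz constant
  1 / c. A solution is a fixed point of \<open>J (G v)\<close>, and the bound c * r on G is what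
  keeps the ball of radius r invariant.\<close>

lemma solve_perturbed_linear_finite_dim:
  assumes B: "finite B" "B \<subseteq> X"
    and add: "\<And>x y. x \<in> span B \<Longrightarrow> y \<in> span B \<Longrightarrow> A (x + y) = A x + A y"
    and scale: "\<And>c x. x \<in> span B \<Longrightarrow> A (c *\<^sub>R x) = c *\<^sub>R A x"
    and into: "A ` span B \<subseteq> span B"
    and c: "0 < c" and lower: "\<And>x. x \<in> span B \<Longrightarrow> c * nrm x \<le> nrm (A x)"
    and r: "0 < r"
    and G: "\<And>v. v \<in> span B \<Longrightarrow> nrm v \<le> r \<Longrightarrow> G v \<in> span B \<and> nrm (G v) \<le> c * r"
    and cont: "continuous_map (subtopology mtopology {v \<in> span B. nrm v \<le> r}) mtopology G"
  obtains v where "v \<in> span B" "nrm v \<le> r" "A v = G v"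
proof -
  have BX: "span B \<subseteq> X" by (rule span_subset_carrier) (rule B)
  have inj: "x = 0" if "x \<in> span B" "A x = 0" for x
    using lower[OF that(1)] that c nrm_pos[of x] BX by (force simp: mult_le_0_iff)
  have surj: "A ` span B = span B"
    by (rule injective_on_finite_span_imp_surjective[OF B(1) add scale into inj])
  define J where "J = inv_into (span B) A"
  have J: "J w \<in> span B" "A (J w) = w" if "w \<in> span B" for w
    using inv_into_into[of w A "span B"] f_inv_into_f[of w A "span B"] that surj
    by (auto simp: J_def)
  have diff: "A (x - y) = A x - A y" if "x \<in> span B" "y \<in> span B" for x y
    using add[of x "- y"] scale[of y "-1"] that by (simp add: span_neg)
  have nJ: "nrm (J w - J w') \<le> (1 / c) * nrm (w - w')" if "w \<in> span B" "w' \<in> span B" for w w'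
    using lower[of "J w - J w'"] J that c by (simp add: diff span_diff field_simps)
  have J0: "J 0 = 0" using inj J[of 0] by (simp add: span_0)
  obtain v where v: "v \<in> span B" "nrm v \<le> r" "J (G v) = v"
  proof (rule Brouwer_finite_dim[OF B r, of "\<lambda>v. J (G v)"])
    show "J (G v) \<in> span B \<and> nrm (J (G v)) \<le> r" if "v \<in> span B" "nrm v \<le> r" for v
    proof -
      have "nrm (J (G v)) \<le> (1 / c) * nrm (G v)"
        using nJ[of "G v" 0] G[OF that] J0 by (simp add: span_0)
      also have "\<dots> \<le> (1 / c) * (c * r)"
        using G[OF that] c by (intro mult_left_mono) auto
      finally show ?thesis
        using J(1)[of "G v"] G[OF that] c by simp
    qed
    show "continuous_map (subtopology mtopology {v \<in> span B. nrm v \<le> r}) mtopology (\<lambda>v. J (G v))"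
    proof (rule continuous_map_Lipschitz_compose[OF cont _ _ nJ])
      show "G ` topspace (subtopology mtopology {v \<in> span B. nrm v \<le> r}) \<subseteq> span B"
        by (auto dest!: G)
      show "J ` span B \<subseteq> X" using J(1) BX by blast
    qed
  qed
  have "A v = G v"
    using J(2)[of "G v"] G[OF v(1,2)] v(3) by simp
  then show thesis by (rule that[OF v(1,2)])
qed

subsection \<open>Approximation by projections\<close>

text \<open>On the unit ball \<open>t *\<^sub>R A h\<close> differs from
  \<open>T (u + t *\<^sub>R h) - T u\<close> by a small multiple of t, uniformly in h. A finite net
  for the image of a small ball under the compact map T therefore yields one for the image of the
  unit ball under A.\<close>

lemma has_frechet_derivative_image_totally_bounded:
  assumes F: "has_frechet_derivative X nrm T A u" and u: "u \<in> X" and T: "T \<in> X \<rightarrow> X"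
    and cc: "completely_continuous X nrm T"
  shows "mtotally_bounded (A ` {h \<in> X. nrm h \<le> 1})"
  unfolding mtotally_bounded_def
proof (intro allI impI)
  fix e :: real assume e: "0 < e"
  have A: "A h \<in> X" if "h \<in> X" for h
    using F that by (auto simp: has_frechet_derivative_def bounded_linear_on_def)
  have A_scale: "A (c *\<^sub>R h) = c *\<^sub>R A h" if "h \<in> X" for c h
    using F that by (auto simp: has_frechet_derivative_def bounded_linear_on_def)
  \<comment> \<open>Two remainders and one net distance, each at most a quarter of e * t, have to
    add up to less than e * t.\<close>
  have "0 < e / 4" using e by simp
  then obtain d where d: "d > 0"
    "\<And>h. h \<in> X \<Longrightarrow> nrm h < d \<Longrightarrow> nrm (T (u + h) - T u - A h) \<le> e / 4 * nrm h"
    using F unfolding has_frechet_derivative_def by blast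
  \<comment> \<open>Half of d, because the remainder estimate needs a norm strictly below d while
    \<open>t *\<^sub>R h\<close> may have norm t.\<close>
  define t where "t = d / 2"
  have t: "0 < t" "t < d" using d by (auto simp: t_def)
  let ?U = "{h \<in> X. nrm h \<le> 1}"
  let ?S = "(\<lambda>h. u + t *\<^sub>R h) ` ?U"
  have "mbounded ?S"
    unfolding mbounded_def
  proof (intro exI subsetI)
    fix y assume "y \<in> ?S"
    then obtain h where "h \<in> X" "nrm h \<le> 1" "y = u + t *\<^sub>R h" by auto
    then show "y \<in> mcball u t"
      using u t nrm_minus[of "t *\<^sub>R h"]
      by (simp add: norm_dist_eq carrier_intros nrm_scaleR mult_left_le)
  qed
  then have "mtotally_bounded (mtopology closure_of (T ` ?S))"
    using cc unfolding completely_continuous_def by (blast intro: compactin_imp_mtotally_bounded)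
  moreover have "T ` ?S \<subseteq> mtopology closure_of (T ` ?S)"
    by (rule closure_of_subset) (use T u in \<open>auto simp: carrier_intros Pi_iff\<close>)
  ultimately have tb: "mtotally_bounded (T ` ?S)"
    by (rule mtotally_bounded_subset)
  have "0 < e * t / 4" using e t by simp
  then have "\<exists>K. finite K \<and> K \<subseteq> T ` ?S \<and> T ` ?S \<subseteq> (\<Union>x\<in>K. mball x (e * t / 4))"
    by (rule tb[unfolded mtotally_bounded_def, THEN spec, THEN mp])
  then obtain K where K: "finite K" "K \<subseteq> T ` ?S" "T ` ?S \<subseteq> (\<Union>x\<in>K. mball x (e * t / 4))"
    by (elim exE conjE)
  \<comment> \<open>The centres of the net are themselves values of T, so they come from finitely
    many vectors H of the unit ball; the images of H under A are the centres of the net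
    sought.\<close>
  have "K \<subseteq> (\<lambda>h. T (u + t *\<^sub>R h)) ` ?U" using K(2) by auto
  then obtain H where H: "H \<subseteq> ?U" "finite H" "K = (\<lambda>h. T (u + t *\<^sub>R h)) ` H"
    using finite_subset_image[OF K(1)] by blast
  have close: "nrm (A h - A g) < e" if h: "h \<in> ?U" and g: "g \<in> ?U"
    and hg: "nrm (T (u + t *\<^sub>R h) - T (u + t *\<^sub>R g)) < e * t / 4" for h g
  proof -
    have rem: "nrm (T (u + t *\<^sub>R h) - T u - t *\<^sub>R A h) \<le> e * t / 4" if "h \<in> ?U" for h
    proof -
      have th: "nrm (t *\<^sub>R h) \<le> t" using that t by (simp add: nrm_scaleR)
      then have "nrm (T (u + t *\<^sub>R h) - T u - A (t *\<^sub>R h)) \<le> e / 4 * nrm (t *\<^sub>R h)"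
        using that t by (intro d) (auto simp: carrier_intros)
      also have "\<dots> \<le> e / 4 * t" using th e by (intro mult_left_mono) auto
      finally show ?thesis using that by (simp add: A_scale)
    qed
    have X: "T (u + t *\<^sub>R h) \<in> X" "T (u + t *\<^sub>R g) \<in> X" "T u \<in> X" "A h \<in> X" "A g \<in> X"
      using T u h g A by (auto simp: carrier_intros Pi_iff)
    let ?a = "T (u + t *\<^sub>R g) - T u - t *\<^sub>R A g" and ?b = "T (u + t *\<^sub>R h) - T u - t *\<^sub>R A h"
    let ?c = "T (u + t *\<^sub>R h) - T (u + t *\<^sub>R g)"
    have "t *\<^sub>R (A h - A g) = (?c + ?a) - ?b" by (simp add: algebra_simps)
    then have "nrm (t *\<^sub>R (A h - A g)) \<le> nrm ?c + nrm ?a + nrm ?b"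
      using nrm_triangle_diff[of "?c + ?a" ?b] nrm_triangle[of ?c ?a] X by (simp add: carrier_intros)
    also have "\<dots> < e * t"
    proof -
      have "0 < e * t" using e t by simp
      then show ?thesis using rem[OF h] rem[OF g] hg by linarith
    qed
    finally show ?thesis
      using t X by (simp add: nrm_scaleR carrier_intros)
  qed
  show "\<exists>K. finite K \<and> K \<subseteq> A ` ?U \<and> A ` ?U \<subseteq> (\<Union>x\<in>K. mball x e)"
  proof (intro exI conjI subsetI)
    show "finite (A ` H)" using H by simp
    fix z assume "z \<in> A ` ?U"
    then obtain h where h: "h \<in> ?U" "z = A h" by auto
    then have "T (u + t *\<^sub>R h) \<in> (\<Union>x\<in>K. mball x (e * t / 4))" using K(3) by blast
    then obtain g where g: "g \<in> H" "T (u + t *\<^sub>R h) \<in> mball (T (u + t *\<^sub>R g)) (e * t / 4)"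
      using H by auto
    then have gU: "g \<in> ?U" using H by auto
    have "nrm (A h - A g) < e"
    proof (rule close[OF h(1) gU])
      have "T (u + t *\<^sub>R g) \<in> X" "T (u + t *\<^sub>R h) \<in> X"
        "norm_dist X nrm (T (u + t *\<^sub>R g)) (T (u + t *\<^sub>R h)) < e * t / 4"
        using g(2) unfolding in_mball by blast+
      then show "nrm (T (u + t *\<^sub>R h) - T (u + t *\<^sub>R g)) < e * t / 4"
        by (simp only: norm_dist_eq nrm_minus_commute[of "T (u + t *\<^sub>R h)"])
    qed
    then have "z \<in> mball (A g) e"
      using h gU A by (simp add: norm_dist_eq nrm_minus_commute)
    then show "z \<in> (\<Union>x\<in>A ` H. mball x e)" using g by blast
  qed (use H in auto)
qed

text \<open>Difference quotients of T at u with steps shorter than d lie in R and approximate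
  \<open>A h\<close> arbitrarily well, and R is closed. This places the range of A where the
  projections are under control.\<close>

lemma has_frechet_derivative_in_closed_subspace:
  assumes F: "has_frechet_derivative X nrm T A u" and u: "u \<in> X"
    and R: "subspace R" "closedin mtopology R"
    and d: "0 < d" "\<And>y. y \<in> X \<Longrightarrow> nrm (y - u) < d \<Longrightarrow> T y \<in> R"
    and h: "h \<in> X"
  shows "A h \<in> R"
proof -
  have A: "A h \<in> X" if "h \<in> X" for h
    using F that by (auto simp: has_frechet_derivative_def bounded_linear_on_def)
  have A_scale: "A (c *\<^sub>R h) = c *\<^sub>R A h" for c
    using F h by (auto simp: has_frechet_derivative_def bounded_linear_on_def)
  have "\<exists>z\<in>R. nrm (z - A h) \<le> e" if e: "0 < e" for e
  proof -
    \<comment> \<open>The summand 1 keeps n positive when h = 0.\<close>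
    define n where "n = nrm h + 1"
    have n: "0 < n" "nrm h \<le> n" using nrm_nonneg[OF h] by (auto simp: n_def)
    have "0 < e / n" using e n by simp
    then obtain d' where d': "d' > 0"
      "\<And>h. h \<in> X \<Longrightarrow> nrm h < d' \<Longrightarrow> nrm (T (u + h) - T u - A h) \<le> e / n * nrm h"
      using F unfolding has_frechet_derivative_def by blast
    define t where "t = min d d' / (2 * n)"
    have t: "0 < t" "t * n < d" "t * n < d'"
      using d(1) d'(1) n by (auto simp: t_def min_def)
    have th: "nrm (t *\<^sub>R h) = t * nrm h" using h t by (simp add: nrm_scaleR)
    also have "\<dots> \<le> t * n" using n t by (intro mult_left_mono) auto
    finally have th': "nrm (t *\<^sub>R h) < d" "nrm (t *\<^sub>R h) < d'" using t by linarith+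
    have TR: "T (u + t *\<^sub>R h) \<in> R" "T u \<in> R"
      using u h th'(1) d(1) by (simp_all add: carrier_intros d(2))
    then have TX: "T (u + t *\<^sub>R h) \<in> X" "T u \<in> X"
      using R(2) by (auto simp: closedin_metric)
    let ?z = "(1 / t) *\<^sub>R (T (u + t *\<^sub>R h) - T u)"
    have "?z - A h = (1 / t) *\<^sub>R (T (u + t *\<^sub>R h) - T u - A (t *\<^sub>R h))"
      using t by (simp add: A_scale algebra_simps)
    then have "nrm (?z - A h) = (1 / t) * nrm (T (u + t *\<^sub>R h) - T u - A (t *\<^sub>R h))"
      using t TX A h by (simp add: nrm_scaleR carrier_intros A_scale)
    also have "\<dots> \<le> (1 / t) * (e / n * nrm (t *\<^sub>R h))"
      using h t th'(2) by (intro mult_left_mono d') (simp_all add: carrier_intros)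
    also have "\<dots> \<le> e"
      using t e n th by (simp add: field_simps)
    finally show ?thesis
      using TR R(1) by (intro bexI[of _ ?z]) (auto intro: subspace_scale subspace_diff)
  qed
  then have "\<exists>z\<in>R. nrm (z - A h) \<le> inverse (real (Suc n))" for n
    by simp
  then obtain z where z: "\<And>n. z n \<in> R" "\<And>n. nrm (z n - A h) \<le> inverse (real (Suc n))"
    by metis
  show ?thesis
  proof (rule closedin_sequence_limit[OF R(2) z(1) A[OF h]])
    show "(\<lambda>n. nrm (z n - A h)) \<longlonglongrightarrow> 0"
      by (rule tendsto_sandwich[OF _ _ tendsto_const LIMSEQ_inverse_real_of_nat])
        (use z A h R(2) in \<open>auto simp: closedin_metric subset_iff intro!: nrm_nonneg carrier_intros always_eventually\<close>)
  qed
qed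

text \<open>Unit vectors g with \<open>g - P N (A g)\<close> tending to 0 have, along a subsequence,
  \<open>A g\<close> convergent to some z in R. Uniform boundedness on R together with convergence
  at the single vector z forces \<open>P N (A g)\<close>, hence g itself, to tend to z. So z is a
  unit vector with A z = z.\<close>

lemma projected_operator_bounded_below:
  assumes complete: mcomplete
    and A: "bounded_linear_on X nrm A" and no_eigenvalue: "\<not> eigenvalue_on X A 1"
    and tb: "mtotally_bounded (A ` {h \<in> X. nrm h \<le> 1})"
    and R: "subspace R" "closedin mtopology R" and A_R: "\<And>h. h \<in> X \<Longrightarrow> A h \<in> R"
    and P_X: "\<And>N y. y \<in> X \<Longrightarrow> P N y \<in> X"
    and P_add: "\<And>N x y. x \<in> X \<Longrightarrow> y \<in> X \<Longrightarrow> P N (x + y) = P N x + P N y"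
    and P_scale: "\<And>N c x. x \<in> X \<Longrightarrow> P N (c *\<^sub>R x) = c *\<^sub>R P N x"
    and P_bounded: "\<And>N y. y \<in> R \<Longrightarrow> nrm (P N y) \<le> M * nrm y"
    and P_conv: "\<And>y. y \<in> R \<Longrightarrow> (\<lambda>N. nrm (y - P N y)) \<longlonglongrightarrow> 0"
  obtains c where "0 < c" "\<forall>\<^sub>F N in sequentially. \<forall>h\<in>X. c * nrm h \<le> nrm (h - P N (A h))"
proof (rule ccontr)
  assume contra: "\<not> thesis"
  have P_diff: "P N (x - y) = P N x - P N y" if "x \<in> X" "y \<in> X" for N x y
    using P_add[of x "- y" N] P_scale[of y N "-1"] that by (simp add: carrier_intros)
  have A_X: "A h \<in> X" if "h \<in> X" for h
    using A that by (auto simp: bounded_linear_on_def)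
  have A_scale: "A (c *\<^sub>R h) = c *\<^sub>R A h" if "h \<in> X" for c h
    using A that by (auto simp: bounded_linear_on_def)
  have A_diff: "A (x - y) = A x - A y" if "x \<in> X" "y \<in> X" for x y
  proof -
    have "A (x + (-1) *\<^sub>R y) = A x + A ((-1) *\<^sub>R y)"
      using A that carrier_intros(3)[OF that(2), of "-1"] unfolding bounded_linear_on_def by blast
    then show ?thesis using A_scale[OF that(2), of "-1"] by simp
  qed
  obtain C where C: "\<And>x. x \<in> X \<Longrightarrow> nrm (A x) \<le> C * nrm x"
    using A unfolding bounded_linear_on_def by blast
  have "\<exists>N\<ge>n. \<exists>g\<in>X. nrm g = 1 \<and> nrm (g - P N (A g)) \<le> inverse (real (Suc n))" for n
  proof -
    \<comment> \<open>The constant 1 / (n + 1) fails for arbitrarily large N, so N can be taken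
      \<ge> n; homogeneity lets the witness be normalised.\<close>
    have "\<not> (\<forall>\<^sub>F N in sequentially. \<forall>h\<in>X. inverse (real (Suc n)) * nrm h \<le> nrm (h - P N (A h)))"
      using contra that[of "inverse (real (Suc n))"] by auto
    then obtain N h where N: "N \<ge> n" and h: "h \<in> X"
      "nrm (h - P N (A h)) < inverse (real (Suc n)) * nrm h"
      unfolding eventually_sequentially by (meson not_le)
    have "0 \<le> nrm (h - P N (A h))"
      by (intro nrm_nonneg carrier_intros h P_X A_X)
    then have "0 < inverse (real (Suc n)) * nrm h" using h(2) by linarith
    then have pos: "0 < nrm h" by (simp add: zero_less_mult_iff)
    let ?g = "(1 / nrm h) *\<^sub>R h"
    have "?g - P N (A ?g) = (1 / nrm h) *\<^sub>R (h - P N (A h))"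
      using h by (simp add: A_scale P_scale A_X algebra_simps)
    then have "nrm (?g - P N (A ?g)) = (1 / nrm h) * nrm (h - P N (A h))"
      using h pos by (simp add: nrm_scaleR carrier_intros P_X A_X)
    also have "\<dots> \<le> inverse (real (Suc n))"
      using h(2) pos by (simp add: field_simps)
    finally have "nrm (?g - P N (A ?g)) \<le> inverse (real (Suc n))" .
    moreover have "nrm ?g = 1" "?g \<in> X" using h pos by (simp_all add: nrm_scaleR carrier_intros)
    ultimately show ?thesis using N by blast
  qed
  then obtain N g where N: "\<And>n. N n \<ge> n" and g: "\<And>n. g n \<in> X" "\<And>n. nrm (g n) = 1"
    and lim: "\<And>n. nrm (g n - P (N n) (A (g n))) \<le> inverse (real (Suc n))"
    by metis
  have "range (A \<circ> g) \<subseteq> A ` {h \<in> X. nrm h \<le> 1}" using g by auto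
  then obtain r where r: "strict_mono r" "MCauchy (A \<circ> g \<circ> r)"
    using tb unfolding mtotally_bounded_sequentially by blast
  then obtain z where z: "limitin mtopology (A \<circ> g \<circ> r) z sequentially"
    using complete unfolding mcomplete_def by blast
  then have zX: "z \<in> X" and Ag: "(\<lambda>n. nrm (A (g (r n)) - z)) \<longlonglongrightarrow> 0"
    by (simp_all add: limitin_iff_nrm_tendsto)
  have zR: "z \<in> R"
    by (rule closedin_sequence_limit[OF R(2) _ zX Ag]) (simp add: A_R g)
  have AgX: "A (g n) \<in> X" for n by (simp add: A_X g)
  have "filterlim (\<lambda>n. N (r n)) at_top sequentially"
    by (rule filterlim_at_top_mono[OF filterlim_ident], rule always_eventually, rule allI,
        rule order_trans[OF seq_suble[OF r(1)] N])
  then have Pz: "(\<lambda>n. nrm (z - P (N (r n)) z)) \<longlonglongrightarrow> 0"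
    by (rule filterlim_compose[OF P_conv[OF zR]])
  have gz: "(\<lambda>n. nrm (g (r n) - z)) \<longlonglongrightarrow> 0"
  proof (rule tendsto_sandwich[OF _ _ tendsto_const])
    show "(\<lambda>n. inverse (real (Suc (r n))) + M * nrm (A (g (r n)) - z) + nrm (z - P (N (r n)) z)) \<longlonglongrightarrow> 0"
      using tendsto_add[OF tendsto_add[OF LIMSEQ_subseq_LIMSEQ[OF LIMSEQ_inverse_real_of_nat r(1)]
            tendsto_mult_right_zero[OF Ag, of M]] Pz]
      by (simp add: o_def del: of_nat_Suc)
    show "\<forall>\<^sub>F n in sequentially. 0 \<le> nrm (g (r n) - z)"
      by (auto intro!: always_eventually nrm_nonneg carrier_intros g zX)
    have "nrm (g (r n) - z) \<le> inverse (real (Suc (r n))) + M * nrm (A (g (r n)) - z) + nrm (z - P (N (r n)) z)" for n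
    proof -
      let ?P = "P (N (r n))" and ?g = "g (r n)"
      \<comment> \<open>Three errors: the defect of g, the projection of \<open>A g - z\<close>,
        bounded uniformly in N because this vector lies in R, and the projection error at the fixed
        vector z.\<close>
      have eq: "?g - z = ((?g - ?P (A ?g)) + ?P (A ?g - z)) - (z - ?P z)"
        by (simp add: P_diff AgX zX)
      have "nrm (?g - z) \<le> nrm (?g - ?P (A ?g)) + nrm (?P (A ?g - z)) + nrm (z - ?P z)"
        unfolding eq
        by (intro order_trans[OF nrm_triangle_diff] add_right_mono nrm_triangle)
          (simp_all add: carrier_intros P_X AgX zX g)
      moreover have "A ?g - z \<in> R"
        by (intro subspace_diff[OF R(1)] A_R g zR)
      ultimately show ?thesis
        using lim[of "r n"] P_bounded[of "A ?g - z" "N (r n)"] by linarith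
    qed
    then show "\<forall>\<^sub>F n in sequentially. nrm (g (r n) - z) \<le>
        inverse (real (Suc (r n))) + M * nrm (A (g (r n)) - z) + nrm (z - P (N (r n)) z)"
      by (intro always_eventually allI)
  qed
  \<comment> \<open>The unit norm survives the limit, which keeps z away from 0.\<close>
  have "1 - nrm z \<le> 0"
    by (rule LIMSEQ_le_const[OF gz])
      (use nrm_triangle_sub[OF g(1) zX] g(2) in \<open>auto simp: algebra_simps\<close>)
  then have z0: "z \<noteq> 0" by auto
  have "(\<lambda>n. C * nrm (g (r n) - z) + nrm (A (g (r n)) - z)) \<longlonglongrightarrow> 0"
    using tendsto_add[OF tendsto_mult_right_zero[OF gz, of C] Ag] by simp
  moreover have "nrm (z - A z) \<le> C * nrm (g (r n) - z) + nrm (A (g (r n)) - z)" for n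
  proof -
    have eq: "z - A z = A (g (r n) - z) - (A (g (r n)) - z)"
      by (simp add: A_diff g zX)
    have "nrm (z - A z) \<le> nrm (A (g (r n) - z)) + nrm (A (g (r n)) - z)"
      unfolding eq by (intro nrm_triangle_diff carrier_intros A_X g zX)
    then show ?thesis using C[of "g (r n) - z"] g zX by (simp add: carrier_intros)
  qed
  ultimately have "nrm (z - A z) \<le> 0"
    by (intro LIMSEQ_le_const) auto
  then have "z - A z = 0"
    using nrm_eq_0[of "z - A z"] nrm_nonneg[of "z - A z"] A_X zX by (simp add: carrier_intros)
  then show False
    using no_eigenvalue z0 zX by (auto simp: eigenvalue_on_def)
qed

text \<open>The domain enters only through a ball of radius d about u on which T takes values in R.
  One \<delta> serves all N. Uniqueness within the \<delta>-ball is not claimed, so existence is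
  stated separately and the rate holds for every choice of solutions in that ball.\<close>

theorem projection_method:
  assumes complete: mcomplete
    and T: "T \<in> X \<rightarrow> X" and cc: "completely_continuous X nrm T"
    and u: "u \<in> X" and f: "f \<in> X" and fix_u: "T u + f = u"
    and F: "has_frechet_derivative X nrm T A u" and no_eigenvalue: "\<not> eigenvalue_on X A 1"
    and R: "subspace R" "closedin mtopology R"
    and d: "0 < d" "\<And>y. y \<in> X \<Longrightarrow> nrm (y - u) < d \<Longrightarrow> T y \<in> R"
    and B: "\<And>N. finite (B N)" "\<And>N. B N \<subseteq> X"
    and P_into: "\<And>N y. y \<in> X \<Longrightarrow> P N y \<in> span (B N)"
    and P_add: "\<And>N x y. x \<in> X \<Longrightarrow> y \<in> X \<Longrightarrow> P N (x + y) = P N x + P N y"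
    and P_scale: "\<And>N c x. x \<in> X \<Longrightarrow> P N (c *\<^sub>R x) = c *\<^sub>R P N x"
    and P_bounded: "\<And>N y. y \<in> R \<Longrightarrow> nrm (P N y) \<le> M * nrm y"
    and P_conv: "\<And>y. y \<in> R \<Longrightarrow> (\<lambda>N. nrm (y - P N y)) \<longlonglongrightarrow> 0"
    and P_conv_f: "(\<lambda>N. nrm (f - P N f)) \<longlonglongrightarrow> 0"
  shows "\<exists>\<delta>>0.
     (\<forall>\<^sub>F N in sequentially. \<exists>v\<in>span (B N). nrm (v - u) < \<delta> \<and> P N (T v) + P N f = v) \<and>
     (\<forall>uN. (\<forall>\<^sub>F N in sequentially. uN N \<in> span (B N) \<and> nrm (uN N - u) < \<delta> \<and>
             P N (T (uN N)) + P N f = uN N) \<longrightarrow>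
        (\<lambda>N. nrm (u - uN N)) \<longlonglongrightarrow> 0 \<and>
        (\<lambda>N. nrm (P N u - u)) \<longlonglongrightarrow> 0 \<and>
        (\<exists>c\<^sub>1>0. \<exists>c\<^sub>2>0. \<forall>\<^sub>F N in sequentially.
           c\<^sub>1 * nrm (P N u - u) \<le> nrm (uN N - u) \<and> nrm (uN N - u) \<le> c\<^sub>2 * nrm (P N u - u)))"
proof -
  have span_X: "span (B N) \<subseteq> X" for N by (rule span_subset_carrier) (rule B)
  have P_X: "P N y \<in> X" if "y \<in> X" for N y using P_into[OF that] span_X by blast
  have P_diff: "P N (x - y) = P N x - P N y" if "x \<in> X" "y \<in> X" for N x y
    using P_add[of x "- y" N] P_scale[of y N "-1"] that by (simp add: carrier_intros)
  have A: "bounded_linear_on X nrm A" using F by (simp add: has_frechet_derivative_def)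
  have A_X: "A h \<in> X" if "h \<in> X" for h using A that by (auto simp: bounded_linear_on_def)
  have A_add: "A (x + y) = A x + A y" if "x \<in> X" "y \<in> X" for x y
    using A that by (auto simp: bounded_linear_on_def)
  have A_scale: "A (c *\<^sub>R h) = c *\<^sub>R A h" if "h \<in> X" for c h
    using A that by (auto simp: bounded_linear_on_def)
  have A_diff: "A (x - y) = A x - A y" if "x \<in> X" "y \<in> X" for x y
    using A_add[of x "- y"] A_scale[of y "-1"] that by (simp add: carrier_intros)
  have A_R: "A h \<in> R" if "h \<in> X" for h
    by (rule has_frechet_derivative_in_closed_subspace[OF F u R d that])
  have T_X: "T y \<in> X" if "y \<in> X" for y using T that by auto
  have Tu_R: "T u \<in> R" by (rule d(2)) (use u d(1) in auto)
  obtain C where C: "0 \<le> C" "\<And>x. x \<in> X \<Longrightarrow> nrm (A x) \<le> C * nrm x"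
  proof -
    obtain C where C: "\<And>x. x \<in> X \<Longrightarrow> nrm (A x) \<le> C * nrm x"
      using A unfolding bounded_linear_on_def by blast
    have "nrm (A x) \<le> \<bar>C\<bar> * nrm x" if "x \<in> X" for x
      using C[OF that] mult_right_mono[OF abs_ge_self nrm_nonneg[OF that], of C] by linarith
    then show thesis by (intro that[of "\<bar>C\<bar>"]) auto
  qed
  \<comment> \<open>Nothing is known about the sign of M, and the constants below divide by
    \<open>M'\<close>.\<close>
  define M' where "M' = max M 1"
  have M': "nrm (P N y) \<le> M' * nrm y" if "y \<in> R" for N y
  proof -
    have "y \<in> X" using that R(2) by (auto simp: closedin_metric)
    then show "nrm (P N y) \<le> M' * nrm y"
      using P_bounded[OF that, of N] mult_right_mono[of M M' "nrm y"] nrm_nonneg[of y]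
      by (simp add: M'_def)
  qed
  have M'_pos: "0 < M'" by (simp add: M'_def)
  have tb: "mtotally_bounded (A ` {h \<in> X. nrm h \<le> 1})"
    by (rule has_frechet_derivative_image_totally_bounded[OF F u T cc])
  obtain c where c: "0 < c" "\<forall>\<^sub>F N in sequentially. \<forall>h\<in>X. c * nrm h \<le> nrm (h - P N (A h))"
    by (rule projected_operator_bounded_below[of A R P M, OF complete A no_eigenvalue tb R A_R P_X
          P_add P_scale P_bounded P_conv])
  \<comment> \<open>Chosen so that projecting the remainder costs at most c / 2 times
    \<open>nrm h\<close>, half of the lower bound c.\<close>
  define e where "e = c / (2 * M')"
  have e: "0 < e" "M' * e = c / 2" using c M'_pos by (simp_all add: e_def)
  obtain d0 where d0: "d0 > 0"
    "\<And>h. h \<in> X \<Longrightarrow> nrm h < d0 \<Longrightarrow> nrm (T (u + h) - T u - A h) \<le> e * nrm h"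
    using F e(1) unfolding has_frechet_derivative_def by blast
  \<comment> \<open>Within d the values of T lie in R, within d0 the remainder is small; its
    projection is estimated by using both.\<close>
  define \<delta> where "\<delta> = min d d0"
  have \<delta>: "0 < \<delta>" "\<delta> \<le> d" "\<delta> \<le> d0" using d d0 by (simp_all add: \<delta>_def)
  let ?rem = "\<lambda>h. T (u + h) - T u - A h"
  have T_R: "T (u + h) \<in> R" if "h \<in> X" "nrm h < \<delta>" for h
    by (rule d(2)) (use that u \<delta> in \<open>auto simp: carrier_intros\<close>)
  have rem: "nrm (P N (?rem h)) \<le> c / 2 * nrm h" if "h \<in> X" "nrm h < \<delta>" for N h
  proof -
    have "?rem h \<in> R" using T_R[OF that] Tu_R A_R[OF that(1)] by (intro subspace_diff[OF R(1)])
    then have "nrm (P N (?rem h)) \<le> M' * nrm (?rem h)" by (rule M')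
    also have "\<dots> \<le> M' * (e * nrm h)"
      using that \<delta> M'_pos by (intro mult_left_mono d0(2)) auto
    also have "\<dots> = c / 2 * nrm h" using e(2) by (simp add: mult.assoc[symmetric])
    finally show ?thesis .
  qed
  have PA: "nrm (P N (A h)) \<le> M' * C * nrm h" if "h \<in> X" for N h
    using order_trans[OF M'[OF A_R[OF that], of N]
        mult_left_mono[OF C(2)[OF that] less_imp_le[OF M'_pos]]]
    by (simp only: mult.assoc)
  have P_fix: "P N (T u) + P N f = P N u" for N
    using P_add[OF T_X[OF u] f, of N] fix_u by simp
  have s_lim: "(\<lambda>N. nrm (P N u - u)) \<longlonglongrightarrow> 0"
  proof (rule tendsto_sandwich[OF _ _ tendsto_const])
    show "(\<lambda>N. nrm (T u - P N (T u)) + nrm (f - P N f)) \<longlonglongrightarrow> 0"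
      using tendsto_add[OF P_conv[OF Tu_R] P_conv_f] by simp
    have "nrm (P N u - u) \<le> nrm (T u - P N (T u)) + nrm (f - P N f)" for N
    proof -
      have "u - P N u = (T u - P N (T u)) + (f - P N f)"
        using P_fix[of N] fix_u by (metis add_diff_add)
      then have "nrm (u - P N u) \<le> nrm (T u - P N (T u)) + nrm (f - P N f)"
        using nrm_triangle[of "T u - P N (T u)" "f - P N f"] u f by (simp add: carrier_intros T_X P_X)
      then show ?thesis using nrm_minus_commute[OF u P_X[OF u]] by simp
    qed
    then show "\<forall>\<^sub>F N in sequentially. nrm (P N u - u) \<le> nrm (T u - P N (T u)) + nrm (f - P N f)"
      by (intro always_eventually allI)
    show "\<forall>\<^sub>F N in sequentially. 0 \<le> nrm (P N u - u)"
      by (intro always_eventually allI nrm_nonneg carrier_intros P_X u)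
  qed
  have estimates: "c / 2 * nrm (v - u) \<le> nrm (P N u - u)"
      "nrm (P N u - u) \<le> (1 + M' * C + c / 2) * nrm (v - u)"
    if N: "\<forall>h\<in>X. c * nrm h \<le> nrm (h - P N (A h))"
      and v: "v \<in> X" "nrm (v - u) < \<delta>" "P N (T v) + P N f = v" for N v
  proof -
    define h where "h = v - u"
    have h: "h \<in> X" "nrm h < \<delta>" using u v by (simp_all add: h_def carrier_intros)
    have v_eq: "v = u + h" by (simp add: h_def)
    have "P N (?rem h) = P N (T v) - P N (T u) - P N (A h)"
      using u v h by (simp add: P_diff T_X A_X carrier_intros flip: v_eq)
    also have "P N (T v) = v - P N f" using v(3) by (simp add: algebra_simps)
    also have "P N (T u) = P N u - P N f" using P_fix[of N] by (simp add: algebra_simps)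
    \<comment> \<open>The projected equation for v minus \<open>P N\<close> applied to the equation
      for u: the terms in f cancel.\<close>
    finally have eq: "P N (?rem h) = h - P N (A h) - (P N u - u)" by (simp add: h_def)
    have X: "P N (?rem h) \<in> X" "P N (A h) \<in> X" "P N u \<in> X"
      using u h by (simp_all add: P_X T_X A_X carrier_intros)
    have "h - P N (A h) = P N (?rem h) + (P N u - u)" unfolding eq by simp
    then have "nrm (h - P N (A h)) \<le> nrm (P N (?rem h)) + nrm (P N u - u)"
      using nrm_triangle[of "P N (?rem h)" "P N u - u"] X u by (simp add: carrier_intros)
    then have "c * nrm h \<le> c / 2 * nrm h + nrm (P N u - u)"
      using bspec[OF N h(1)] rem[OF h, of N] by linarith
    then show "c / 2 * nrm (v - u) \<le> nrm (P N u - u)" by (simp add: h_def field_simps)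
    have "P N u - u = (h - P N (A h)) - P N (?rem h)" unfolding eq by simp
    then have "nrm (P N u - u) \<le> nrm h + nrm (P N (A h)) + nrm (P N (?rem h))"
      using nrm_triangle_diff[of "h - P N (A h)" "P N (?rem h)"] nrm_triangle_diff[of h "P N (A h)"] X h
      by (simp add: carrier_intros)
    then show "nrm (P N u - u) \<le> (1 + M' * C + c / 2) * nrm (v - u)"
      using PA[OF h(1), of N] rem[OF h, of N] by (simp add: h_def algebra_simps)
  qed
  have existence: "\<exists>v\<in>span (B N). nrm (v - u) < \<delta> \<and> P N (T v) + P N f = v"
    if N: "\<forall>h\<in>X. c * nrm h \<le> nrm (h - P N (A h))"
      and s1: "nrm (P N u - u) < \<delta> / 2"
      and s2: "(c / 2 + M' * C) * nrm (P N u - u) \<le> c / 2 * (\<delta> / 2)" for N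
  proof -
    \<comment> \<open>\<open>s1\<close> keeps w within \<delta> / 2 of u, which leaves the other
      half of \<delta> to the deviation v from w.\<close>
    define r where "r = \<delta> / 2"
    have r: "0 < r" using \<delta> by (simp add: r_def)
    define w where "w = P N u"
    have w: "w \<in> X" "w \<in> span (B N)" "w - u \<in> X"
      using u P_X P_into by (simp_all add: w_def carrier_intros)
    \<comment> \<open>Since \<open>P N (T u) + P N f = w\<close>, the vector w + v solves the
      projected equation iff \<open>v = P N (T (w + v) - T u)\<close>. Subtracting
      \<open>P N (A v)\<close> leaves the invertible linear part on the left and G v on the
      right.\<close>
    define G where "G v = P N (T (w + v) - T u - A v)" for v
    have small: "nrm (w - u + v) < \<delta>" if "v \<in> X" "nrm v \<le> r" for v
      using nrm_triangle[OF w(3) that(1)] that s1 by (simp add: w_def r_def)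
    have GR: "T (w + v) - T u - A v \<in> R" if "v \<in> X" "nrm v \<le> r" for v
    proof -
      have "T (u + (w - u + v)) \<in> R"
        using T_R[of "w - u + v"] small[OF that] that w by (simp add: carrier_intros)
      then show ?thesis using Tu_R A_R[OF that(1)] by (intro subspace_diff[OF R(1)]) (simp_all add: algebra_simps)
    qed
    have RX: "R \<subseteq> X" using R(2) by (simp add: closedin_metric)
    let ?Z = "subtopology mtopology {v \<in> span (B N). nrm v \<le> r}"
    have Z: "topspace ?Z = {v \<in> span (B N). nrm v \<le> r}" using span_X by auto
    have cont_id: "continuous_map ?Z mtopology (\<lambda>v. v)"
      by (rule continuous_map_from_subtopology) simp
    have "continuous_map ?Z mtopology (T \<circ> (\<lambda>v. w + v))"
      using cc w(1) unfolding completely_continuous_def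
      by (intro continuous_map_compose[of _ mtopology] continuous_map_carrier_add cont_id) auto
    then have "continuous_map ?Z mtopology (\<lambda>v. T (w + v))" by (simp add: o_def)
    moreover have "continuous_map ?Z mtopology (\<lambda>v. A v)"
      by (rule continuous_map_Lipschitz_compose[OF cont_id, of X _ C])
        (use span_X A_X C(2) in \<open>auto simp: A_diff[symmetric] carrier_intros\<close>)
    ultimately have cont: "continuous_map ?Z mtopology (\<lambda>v. T (w + v) - T u - A v)"
      using T_X[OF u] by (intro continuous_map_carrier_diff) auto
    have contG: "continuous_map ?Z mtopology G"
      unfolding G_def
    proof (rule continuous_map_Lipschitz_compose[OF cont, of R "P N" M'])
      show "(\<lambda>v. T (w + v) - T u - A v) ` topspace ?Z \<subseteq> R"
        unfolding Z using GR span_X by blast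
      show "P N ` R \<subseteq> X" using P_X RX by blast
      fix x y assume xy: "x \<in> R" "y \<in> R"
      then have "x \<in> X" "y \<in> X" using RX by auto
      then show "nrm (P N x - P N y) \<le> M' * nrm (x - y)"
        using M'[OF subspace_diff[OF R(1) xy], of N] by (simp add: P_diff)
    qed
    obtain v where v: "v \<in> span (B N)" "nrm v \<le> r" "v - P N (A v) = G v"
    proof (rule solve_perturbed_linear_finite_dim[OF B, of N "\<lambda>v. v - P N (A v)" c r G])
      show "x + y - P N (A (x + y)) = x - P N (A x) + (y - P N (A y))"
        if "x \<in> span (B N)" "y \<in> span (B N)" for x y
        using that span_X[of N] by (simp add: A_add P_add A_X subset_iff)
      show "a *\<^sub>R x - P N (A (a *\<^sub>R x)) = a *\<^sub>R (x - P N (A x))" if "x \<in> span (B N)" for a x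
        using that span_X[of N] by (simp add: A_scale P_scale A_X subset_iff algebra_simps)
      show "(\<lambda>v. v - P N (A v)) ` span (B N) \<subseteq> span (B N)"
        using span_X[of N] P_into A_X by (auto intro!: span_diff)
      show "c * nrm x \<le> nrm (x - P N (A x))" if "x \<in> span (B N)" for x
        using that span_X[of N] N by blast
      show "G v \<in> span (B N) \<and> nrm (G v) \<le> c * r" if v: "v \<in> span (B N)" "nrm v \<le> r" for v
      proof
        have vX: "v \<in> X" using v span_X by blast
        show "G v \<in> span (B N)"
          unfolding G_def by (intro P_into) (use vX u w in \<open>simp add: carrier_intros T_X A_X\<close>)
        \<comment> \<open>h is the deviation from u, not from w, since the remainder estimate is
          centred at u. The shift costs the term \<open>A (w - u)\<close>, which becomes small for
          large N.\<close>
        define h where "h = w - u + v"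
        have h: "h \<in> X" "nrm h < \<delta>" using small[OF vX v(2)] w vX by (simp_all add: h_def carrier_intros)
        have wv: "w + v = u + h" by (simp add: h_def)
        have "A v = A h - A (w - u)"
          using A_diff[OF h(1) w(3)] by (simp add: h_def)
        then have eq: "T (w + v) - T u - A v = ?rem h + A (w - u)"
          unfolding wv by simp
        have "G v = P N (?rem h) + P N (A (w - u))"
          unfolding G_def eq using u h w by (intro P_add) (simp_all add: carrier_intros T_X A_X)
        then have "nrm (G v) \<le> nrm (P N (?rem h)) + nrm (P N (A (w - u)))"
          using nrm_triangle[of "P N (?rem h)" "P N (A (w - u))"] u h w
          by (simp add: P_X carrier_intros T_X A_X)
        also have "\<dots> \<le> c / 2 * nrm h + M' * C * nrm (w - u)"
          using rem[OF h, of N] PA[OF w(3), of N] by linarith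
        also have "\<dots> \<le> c / 2 * (nrm (w - u) + r) + M' * C * nrm (w - u)"
          using nrm_triangle[OF w(3) vX] v(2) c(1) by (intro add_right_mono mult_left_mono) (auto simp: h_def)
        \<comment> \<open>One half of c * r is the term c / 2 * r; the other half is what
          \<open>s2\<close> grants to the two terms in \<open>nrm (w - u)\<close>.\<close>
        also have "\<dots> \<le> c * r"
          using s2 by (simp add: w_def r_def algebra_simps)
        finally show "nrm (G v) \<le> c * r" .
      qed
    qed (use r c contG in auto)
    have vX: "v \<in> X" using v span_X by blast
    have "v = P N (T (w + v)) - P N (T u)"
      using v(3) unfolding G_def using vX u w by (simp add: P_diff T_X A_X carrier_intros)
    then have "P N (T (w + v)) = v + P N (T u)" by (simp add: algebra_simps)
    then have "P N (T (w + v)) + P N f = v + (P N (T u) + P N f)" by (simp only: add.assoc)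
    also have "\<dots> = w + v" unfolding P_fix by (simp add: w_def)
    finally have "P N (T (w + v)) + P N f = w + v" .
    moreover have "nrm (w + v - u) < \<delta>"
      using small[OF vX v(2)] by (simp add: algebra_simps)
    moreover have "w + v \<in> span (B N)" using w v by (simp add: span_add)
    ultimately show ?thesis by blast
  qed
  have s1: "\<forall>\<^sub>F N in sequentially. nrm (P N u - u) < \<delta> / 2"
    using order_tendstoD(2)[OF s_lim, of "\<delta> / 2"] \<delta>(1) by simp
  have s2: "\<forall>\<^sub>F N in sequentially. (c / 2 + M' * C) * nrm (P N u - u) \<le> c / 2 * (\<delta> / 2)"
  proof -
    have "(\<lambda>N. (c / 2 + M' * C) * nrm (P N u - u)) \<longlonglongrightarrow> 0"
      by (rule tendsto_mult_right_zero[OF s_lim])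
    then have "\<forall>\<^sub>F N in sequentially. (c / 2 + M' * C) * nrm (P N u - u) < c / 2 * (\<delta> / 2)"
      by (rule order_tendstoD) (use c \<delta> in simp)
    then show ?thesis by (rule eventually_mono) simp
  qed
  show ?thesis
  proof (rule exI[of _ \<delta>], intro conjI allI impI)
    show "\<forall>\<^sub>F N in sequentially. \<exists>v\<in>span (B N). nrm (v - u) < \<delta> \<and> P N (T v) + P N f = v"
      using c(2) s1 s2 by eventually_elim (rule existence)
    fix uN assume uN: "\<forall>\<^sub>F N in sequentially. uN N \<in> span (B N) \<and> nrm (uN N - u) < \<delta> \<and>
        P N (T (uN N)) + P N f = uN N"
    have ev: "\<forall>\<^sub>F N in sequentially. uN N \<in> X \<and> c / 2 * nrm (uN N - u) \<le> nrm (P N u - u) \<and>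
        nrm (P N u - u) \<le> (1 + M' * C + c / 2) * nrm (uN N - u)"
      using c(2) uN
    proof eventually_elim
      case (elim N)
      then have "uN N \<in> X" using span_X by blast
      with elim estimates[of N "uN N"] show ?case by blast
    qed
    show "(\<lambda>N. nrm (u - uN N)) \<longlonglongrightarrow> 0"
    proof (rule tendsto_sandwich[OF _ _ tendsto_const])
      show "(\<lambda>N. (2 / c) * nrm (P N u - u)) \<longlonglongrightarrow> 0"
        by (rule tendsto_mult_right_zero[OF s_lim])
      show "\<forall>\<^sub>F N in sequentially. 0 \<le> nrm (u - uN N)"
        using ev by eventually_elim (simp add: nrm_nonneg carrier_intros u)
      show "\<forall>\<^sub>F N in sequentially. nrm (u - uN N) \<le> (2 / c) * nrm (P N u - u)"
        using ev by eventually_elim (use c u in \<open>simp add: nrm_minus_commute[of u] field_simps\<close>)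
    qed
    show "(\<lambda>N. nrm (P N u - u)) \<longlonglongrightarrow> 0" by (rule s_lim)
    have pos: "0 < 1 + M' * C + c / 2" using c C M'_pos by (simp add: add_pos_nonneg)
    show "\<exists>c\<^sub>1>0. \<exists>c\<^sub>2>0. \<forall>\<^sub>F N in sequentially.
        c\<^sub>1 * nrm (P N u - u) \<le> nrm (uN N - u) \<and> nrm (uN N - u) \<le> c\<^sub>2 * nrm (P N u - u)"
    proof (intro exI conjI)
      show "0 < 1 / (1 + M' * C + c / 2)" "0 < 2 / c" using pos c by simp_all
      show "\<forall>\<^sub>F N in sequentially. 1 / (1 + M' * C + c / 2) * nrm (P N u - u) \<le> nrm (uN N - u) \<and>
          nrm (uN N - u) \<le> 2 / c * nrm (P N u - u)"
        using ev
      proof eventually_elim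
        case (elim N)
        then show ?case using c pos by (simp add: divide_le_eq le_divide_eq mult.commute)
      qed
    qed
  qed (rule \<delta>)
qed

end

section \<open>The Hoelder spaces are Banach spaces\<close>

lemma holder_norm_sup_upper:
  assumes f: "f \<in> holder_space k \<beta>" and \<beta>: "0 < \<beta>" and r: "r \<le> k" and x: "x \<in> {-1..1}"
  shows "\<bar>(deriv_I ^^ r) f x\<bar> \<le> (MAX r\<in>{..k}. SUP x\<in>{-1..1}. \<bar>(deriv_I ^^ r) f x\<bar>)"
proof -
  have "\<bar>(deriv_I ^^ r) f x\<bar> \<le> (SUP x\<in>{-1..1}. \<bar>(deriv_I ^^ r) f x\<bar>)"
    by (rule cSUP_upper[OF x holder_space_deriv_bounded[OF f \<beta> r]])
  also have "\<dots> \<le> (MAX r\<in>{..k}. SUP x\<in>{-1..1}. \<bar>(deriv_I ^^ r) f x\<bar>)"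
    using r by (intro Max_ge) auto
  finally show ?thesis .
qed

text \<open>Trades the maximum and the suprema for pointwise inequalities with two numbers, a bound
  on the derivatives and a Hoelder constant. With \<open>holder_norm_le\<close> as a converse,
  scaling and completeness can be handled pointwise.\<close>

lemma holder_norm_bounds:
  assumes f: "f \<in> holder_space k \<beta>" and \<beta>: "0 < \<beta>"
  obtains a b where "holder_norm k \<beta> f = a + b" "0 \<le> a" "0 \<le> b"
    "\<And>r x. r \<le> k \<Longrightarrow> x \<in> {-1..1} \<Longrightarrow> \<bar>(deriv_I ^^ r) f x\<bar> \<le> a"
    "\<And>x y. x \<in> {-1..1} \<Longrightarrow> y \<in> {-1..1} \<Longrightarrow>
       \<bar>(deriv_I ^^ k) f x - (deriv_I ^^ k) f y\<bar> \<le> b * \<bar>x - y\<bar> powr \<beta>"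
proof -
  let ?S = "{(x, y). x \<in> {-1..1} \<and> y \<in> {-1..1} \<and> x \<noteq> y} :: (real \<times> real) set"
  let ?q = "\<lambda>(x, y). \<bar>(deriv_I ^^ k) f x - (deriv_I ^^ k) f y\<bar> / \<bar>x - y\<bar> powr \<beta>"
  define a where "a = (MAX r\<in>{..k}. SUP x\<in>{-1..1}. \<bar>(deriv_I ^^ r) f x\<bar>)"
  define b where "b = (SUP z\<in>?S. ?q z)"
  have a: "\<bar>(deriv_I ^^ r) f x\<bar> \<le> a" if "r \<le> k" "x \<in> {-1..1}" for r x
    unfolding a_def by (rule holder_norm_sup_upper[OF f \<beta> that])
  have q: "?q z \<le> b" if "z \<in> ?S" for z
    unfolding b_def by (rule cSUP_upper[OF that holder_space_quotient_bounded[OF f]])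
  have "0 \<le> a" using a[of 0 0] by simp
  moreover have "0 \<le> b" using q[of "(0, 1)"] by simp
  moreover have "\<bar>(deriv_I ^^ k) f x - (deriv_I ^^ k) f y\<bar> \<le> b * \<bar>x - y\<bar> powr \<beta>"
    if "x \<in> {-1..1}" "y \<in> {-1..1}" for x y
    using q[of "(x, y)"] that by (cases "x = y") (simp_all add: divide_le_eq)
  moreover have "holder_norm k \<beta> f = a + b"
    by (simp add: holder_norm_def a_def b_def)
  ultimately show thesis using a by (intro that)
qed

lemma holder_norm_le:
  assumes "\<And>r x. r \<le> k \<Longrightarrow> x \<in> {-1..1} \<Longrightarrow> \<bar>(deriv_I ^^ r) f x\<bar> \<le> a"
    and "\<And>x y. x \<in> {-1..1} \<Longrightarrow> y \<in> {-1..1} \<Longrightarrow>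
       \<bar>(deriv_I ^^ k) f x - (deriv_I ^^ k) f y\<bar> \<le> b * \<bar>x - y\<bar> powr \<beta>"
  shows "holder_norm k \<beta> f \<le> a + b"
proof -
  let ?S = "{(x, y). x \<in> {-1..1} \<and> y \<in> {-1..1} \<and> x \<noteq> y} :: (real \<times> real) set"
  have "(MAX r\<in>{..k}. SUP x\<in>{-1..1}. \<bar>(deriv_I ^^ r) f x\<bar>) \<le> a"
    using assms(1) by (subst Max_le_iff) (auto intro!: cSUP_least)
  moreover have "(SUP (x, y)\<in>?S. \<bar>(deriv_I ^^ k) f x - (deriv_I ^^ k) f y\<bar> / \<bar>x - y\<bar> powr \<beta>) \<le> b"
  proof (rule cSUP_least)
    have "(0, 1) \<in> ?S" by simp
    then show "?S \<noteq> {}" by blast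
    show "(case z of (x, y) \<Rightarrow> \<bar>(deriv_I ^^ k) f x - (deriv_I ^^ k) f y\<bar> / \<bar>x - y\<bar> powr \<beta>) \<le> b"
      if "z \<in> ?S" for z
      using that assms(2) by (auto simp: divide_le_eq)
  qed
  ultimately show ?thesis unfolding holder_norm_def by linarith
qed

lemma holder_norm_scaleR:
  assumes f: "f \<in> holder_space k \<beta>" and \<beta>: "0 < \<beta>"
  shows "holder_norm k \<beta> (c *\<^sub>R f) = \<bar>c\<bar> * holder_norm k \<beta> f"
proof (rule antisym)
  have le: "holder_norm k \<beta> (c *\<^sub>R f) \<le> \<bar>c\<bar> * holder_norm k \<beta> f" if f: "f \<in> holder_space k \<beta>" for c f
  proof -
    obtain a b where ab: "holder_norm k \<beta> f = a + b"
      "\<And>r x. r \<le> k \<Longrightarrow> x \<in> {-1..1} \<Longrightarrow> \<bar>(deriv_I ^^ r) f x\<bar> \<le> a"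
      "\<And>x y. x \<in> {-1..1} \<Longrightarrow> y \<in> {-1..1} \<Longrightarrow>
         \<bar>(deriv_I ^^ k) f x - (deriv_I ^^ k) f y\<bar> \<le> b * \<bar>x - y\<bar> powr \<beta>"
      using holder_norm_bounds[OF f \<beta>] by metis
    have d: "(deriv_I ^^ r) (c *\<^sub>R f) x = c * (deriv_I ^^ r) f x" if "r \<le> k" for r x
      using holder_space_deriv_lincomb[OF f f that, of c 0] by simp
    have "holder_norm k \<beta> (c *\<^sub>R f) \<le> \<bar>c\<bar> * a + \<bar>c\<bar> * b"
    proof (rule holder_norm_le)
      show "\<bar>(deriv_I ^^ r) (c *\<^sub>R f) x\<bar> \<le> \<bar>c\<bar> * a" if "r \<le> k" "x \<in> {-1..1}" for r x
        unfolding d[OF that(1)] abs_mult by (intro mult_left_mono ab that) simp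
      show "\<bar>(deriv_I ^^ k) (c *\<^sub>R f) x - (deriv_I ^^ k) (c *\<^sub>R f) y\<bar> \<le> \<bar>c\<bar> * b * \<bar>x - y\<bar> powr \<beta>"
        if "x \<in> {-1..1}" "y \<in> {-1..1}" for x y
        unfolding d[OF order_refl] right_diff_distrib[symmetric] abs_mult mult.assoc
        by (intro mult_left_mono ab that) simp
    qed
    then show ?thesis by (simp add: ab(1) distrib_left)
  qed
  show "holder_norm k \<beta> (c *\<^sub>R f) \<le> \<bar>c\<bar> * holder_norm k \<beta> f" by (rule le[OF f])
  show "\<bar>c\<bar> * holder_norm k \<beta> f \<le> holder_norm k \<beta> (c *\<^sub>R f)"
  proof (cases "c = 0")
    case True
    have "0 \<le> holder_norm k \<beta> (c *\<^sub>R f)"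
      using abs_le_holder_norm[of "c *\<^sub>R f" k \<beta> 0] subspace_scale[OF subspace_holder_space f] \<beta>
      by (meson abs_ge_zero order_trans)
    then show ?thesis using True by simp
  next
    case False
    have "holder_norm k \<beta> (inverse c *\<^sub>R (c *\<^sub>R f)) \<le> \<bar>inverse c\<bar> * holder_norm k \<beta> (c *\<^sub>R f)"
      by (rule le) (rule subspace_scale[OF subspace_holder_space f])
    then show ?thesis using False by (simp add: field_simps)
  qed
qed

lemma normed_subspace_holder:
  assumes \<beta>: "0 < \<beta>"
  shows "normed_subspace (holder_space k \<beta>) (holder_norm k \<beta>)"
proof
  show "subspace (holder_space k \<beta>)" by (rule subspace_holder_space)
  fix f assume f: "f \<in> holder_space k \<beta>"
  note le = abs_le_holder_norm[OF f \<beta>]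
  show "0 \<le> holder_norm k \<beta> f" using le[of 0] by linarith
  show "f = 0" if "holder_norm k \<beta> f = 0"
    using le that by (simp add: fun_eq_iff)
  show "holder_norm k \<beta> (c *\<^sub>R f) = \<bar>c\<bar> * holder_norm k \<beta> f" for c
    by (rule holder_norm_scaleR[OF f \<beta>])
  show "holder_norm k \<beta> (f + g) \<le> holder_norm k \<beta> f + holder_norm k \<beta> g" if "g \<in> holder_space k \<beta>" for g
    by (rule holder_norm_triangle[OF f that \<beta>])
qed

text \<open>All derivatives up to order k converge uniformly, so they commute with the limit. The
  Hoelder estimate for differences of members of the sequence passes to the limit at each fixed pair
  of points, which gives convergence in the full norm.\<close>

lemma holder_space_Cauchy_limit:
  assumes \<beta>: "0 < \<beta>" and g: "\<And>n. g n \<in> holder_space k \<beta>"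
    and cauchy: "\<And>e. 0 < e \<Longrightarrow> \<exists>N. \<forall>m\<ge>N. \<forall>n\<ge>N. holder_norm k \<beta> (g m - g n) < e"
  obtains l where "l \<in> holder_space k \<beta>" "(\<lambda>n. holder_norm k \<beta> (g n - l)) \<longlonglongrightarrow> 0"
proof -
  let ?X = "holder_space k \<beta>"
  have diff: "g m - g n \<in> ?X" for m n
    by (rule subspace_diff[OF subspace_holder_space g g])
  have D_diff: "(deriv_I ^^ r) (f - h) x = (deriv_I ^^ r) f x - (deriv_I ^^ r) h x"
    if "f \<in> ?X" "h \<in> ?X" "r \<le> k" for r f h x
    using holder_space_deriv_lincomb[OF that, of 1 "-1"] by simp
  have close: "\<exists>N. \<forall>m\<ge>N. \<forall>n\<ge>N.
      (\<forall>r\<le>k. \<forall>x\<in>{-1..1}. \<bar>(deriv_I ^^ r) (g m) x - (deriv_I ^^ r) (g n) x\<bar> \<le> e) \<and>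
      (\<forall>x\<in>{-1..1}. \<forall>y\<in>{-1..1}. \<bar>((deriv_I ^^ k) (g m) x - (deriv_I ^^ k) (g n) x) -
         ((deriv_I ^^ k) (g m) y - (deriv_I ^^ k) (g n) y)\<bar> \<le> e * \<bar>x - y\<bar> powr \<beta>)"
    if "0 < e" for e
  proof -
    obtain N where N: "\<And>m n. m \<ge> N \<Longrightarrow> n \<ge> N \<Longrightarrow> holder_norm k \<beta> (g m - g n) < e"
      using cauchy[OF \<open>0 < e\<close>] by blast
    show ?thesis
    proof (intro exI[of _ N] allI impI)
      fix m n assume mn: "N \<le> m" "N \<le> n"
      obtain a b where ab: "holder_norm k \<beta> (g m - g n) = a + b" "0 \<le> a" "0 \<le> b"
        "\<And>r x. r \<le> k \<Longrightarrow> x \<in> {-1..1} \<Longrightarrow> \<bar>(deriv_I ^^ r) (g m - g n) x\<bar> \<le> a"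
        "\<And>x y. x \<in> {-1..1} \<Longrightarrow> y \<in> {-1..1} \<Longrightarrow>
           \<bar>(deriv_I ^^ k) (g m - g n) x - (deriv_I ^^ k) (g m - g n) y\<bar> \<le> b * \<bar>x - y\<bar> powr \<beta>"
        by (rule holder_norm_bounds[OF diff[of m n] \<beta>]) (rule that)
      have le: "a \<le> e" "b \<le> e" using ab(1-3) N[OF mn] by linarith+
      have "\<bar>(deriv_I ^^ r) (g m) x - (deriv_I ^^ r) (g n) x\<bar> \<le> e" if "r \<le> k" "x \<in> {-1..1}" for r x
        using order_trans[OF ab(4)[OF that] le(1)] by (simp only: D_diff[OF g g that(1)])
      moreover have "\<bar>((deriv_I ^^ k) (g m) x - (deriv_I ^^ k) (g n) x) -
         ((deriv_I ^^ k) (g m) y - (deriv_I ^^ k) (g n) y)\<bar> \<le> e * \<bar>x - y\<bar> powr \<beta>"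
        if "x \<in> {-1..1}" "y \<in> {-1..1}" for x y
        using order_trans[OF ab(5)[OF that] mult_right_mono[OF le(2)]]
        by (simp only: D_diff[OF g g order_refl] powr_ge_zero)
      ultimately show "(\<forall>r\<le>k. \<forall>x\<in>{-1..1}. \<bar>(deriv_I ^^ r) (g m) x - (deriv_I ^^ r) (g n) x\<bar> \<le> e) \<and>
        (\<forall>x\<in>{-1..1}. \<forall>y\<in>{-1..1}. \<bar>((deriv_I ^^ k) (g m) x - (deriv_I ^^ k) (g n) x) -
         ((deriv_I ^^ k) (g m) y - (deriv_I ^^ k) (g n) y)\<bar> \<le> e * \<bar>x - y\<bar> powr \<beta>)"
        by blast
    qed
  qed
  \<comment> \<open>The value 0 off the interval matches both membership in the space and the
    convention in \<open>deriv_I\<close>.\<close>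
  define G where "G r x = (if x \<in> {-1..1} then lim (\<lambda>n. (deriv_I ^^ r) (g n) x) else 0)" for r x
  have lim_G: "(\<lambda>n. (deriv_I ^^ r) (g n) x) \<longlonglongrightarrow> G r x" if "r \<le> k" "x \<in> {-1..1}" for r x
  proof -
    have "Cauchy (\<lambda>n. (deriv_I ^^ r) (g n) x)"
    proof (rule metric_CauchyI)
      fix e :: real assume "0 < e"
      then obtain N where "\<forall>m\<ge>N. \<forall>n\<ge>N. \<forall>r\<le>k. \<forall>x\<in>{-1..1}.
          \<bar>(deriv_I ^^ r) (g m) x - (deriv_I ^^ r) (g n) x\<bar> \<le> e / 2"
        using close[of "e / 2"] by (meson half_gt_zero)
      then have "\<forall>m\<ge>N. \<forall>n\<ge>N. \<bar>(deriv_I ^^ r) (g m) x - (deriv_I ^^ r) (g n) x\<bar> \<le> e / 2"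
        using that by blast
      then show "\<exists>N. \<forall>m\<ge>N. \<forall>n\<ge>N. dist ((deriv_I ^^ r) (g m) x) ((deriv_I ^^ r) (g n) x) < e"
        using \<open>0 < e\<close> by (intro exI[of _ N]) (force simp: dist_real_def)
    qed
    then show ?thesis
      using that by (simp add: G_def convergent_LIMSEQ_iff[symmetric] Cauchy_convergent_iff)
  qed
  have close_G: "\<exists>N. \<forall>m\<ge>N.
      (\<forall>r\<le>k. \<forall>x\<in>{-1..1}. \<bar>(deriv_I ^^ r) (g m) x - G r x\<bar> \<le> e) \<and>
      (\<forall>x\<in>{-1..1}. \<forall>y\<in>{-1..1}. \<bar>((deriv_I ^^ k) (g m) x - G k x) -
         ((deriv_I ^^ k) (g m) y - G k y)\<bar> \<le> e * \<bar>x - y\<bar> powr \<beta>)"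
    if e: "0 < e" for e
  proof -
    obtain N where N: "\<And>m n r x. m \<ge> N \<Longrightarrow> n \<ge> N \<Longrightarrow> r \<le> k \<Longrightarrow> x \<in> {-1..1} \<Longrightarrow>
        \<bar>(deriv_I ^^ r) (g m) x - (deriv_I ^^ r) (g n) x\<bar> \<le> e"
      "\<And>m n x y. m \<ge> N \<Longrightarrow> n \<ge> N \<Longrightarrow> x \<in> {-1..1} \<Longrightarrow> y \<in> {-1..1} \<Longrightarrow>
        \<bar>((deriv_I ^^ k) (g m) x - (deriv_I ^^ k) (g n) x) -
         ((deriv_I ^^ k) (g m) y - (deriv_I ^^ k) (g n) y)\<bar> \<le> e * \<bar>x - y\<bar> powr \<beta>"
      using close[OF e] by metis
    have "\<bar>(deriv_I ^^ r) (g m) x - G r x\<bar> \<le> e" if "m \<ge> N" "r \<le> k" "x \<in> {-1..1}" for m r x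
    proof (rule LIMSEQ_le_const2)
      show "(\<lambda>n. \<bar>(deriv_I ^^ r) (g m) x - (deriv_I ^^ r) (g n) x\<bar>) \<longlonglongrightarrow> \<bar>(deriv_I ^^ r) (g m) x - G r x\<bar>"
        by (intro tendsto_intros lim_G that)
      show "\<exists>N. \<forall>n\<ge>N. \<bar>(deriv_I ^^ r) (g m) x - (deriv_I ^^ r) (g n) x\<bar> \<le> e"
        using N(1)[OF that(1) _ that(2,3)] by blast
    qed
    moreover have "\<bar>((deriv_I ^^ k) (g m) x - G k x) - ((deriv_I ^^ k) (g m) y - G k y)\<bar> \<le> e * \<bar>x - y\<bar> powr \<beta>"
      if "m \<ge> N" "x \<in> {-1..1}" "y \<in> {-1..1}" for m x y
    proof (rule LIMSEQ_le_const2)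
      show "(\<lambda>n. \<bar>((deriv_I ^^ k) (g m) x - (deriv_I ^^ k) (g n) x) -
         ((deriv_I ^^ k) (g m) y - (deriv_I ^^ k) (g n) y)\<bar>) \<longlonglongrightarrow>
         \<bar>((deriv_I ^^ k) (g m) x - G k x) - ((deriv_I ^^ k) (g m) y - G k y)\<bar>"
        by (intro tendsto_intros lim_G that order_refl)
      show "\<exists>N. \<forall>n\<ge>N. \<bar>((deriv_I ^^ k) (g m) x - (deriv_I ^^ k) (g n) x) -
         ((deriv_I ^^ k) (g m) y - (deriv_I ^^ k) (g n) y)\<bar> \<le> e * \<bar>x - y\<bar> powr \<beta>"
        using N(2)[OF that(1) _ that(2,3)] by blast
    qed
    ultimately show ?thesis by blast
  qed
  have deriv_G: "(G r has_vector_derivative G (Suc r) x) (at x within {-1..1})"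
    if r: "r < k" and x: "x \<in> {-1..1}" for r x
  proof -
    have "\<exists>h. \<forall>x\<in>{-1..1}. (\<lambda>n. (deriv_I ^^ r) (g n) x) \<longlonglongrightarrow> h x \<and>
        (h has_derivative (\<lambda>t. t * G (Suc r) x)) (at x within {-1..1})"
    proof (rule has_derivative_sequence)
      show "((deriv_I ^^ r) (g n) has_derivative (\<lambda>t. t * (deriv_I ^^ Suc r) (g n) x)) (at x within {-1..1})"
        if "x \<in> {-1..1}" for n x
      proof -
        have "(deriv_I ^^ r) (g n) differentiable_on {-1..1}"
          using g[of n] r by (simp add: holder_space_def)
        then have "((deriv_I ^^ r) (g n) has_vector_derivative
            vector_derivative ((deriv_I ^^ r) (g n)) (at x within {-1..1})) (at x within {-1..1})"
          using that by (simp add: differentiable_on_def vector_derivative_works)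
        then show ?thesis
          using that by (simp add: deriv_I_def has_vector_derivative_def)
      qed
      show "\<forall>\<^sub>F n in sequentially. \<forall>x\<in>{-1..1}. \<forall>t. norm (t * (deriv_I ^^ Suc r) (g n) x - t * G (Suc r) x) \<le> e * norm t"
        if e: "0 < e" for e
      proof -
        obtain N where N: "\<And>m x. m \<ge> N \<Longrightarrow> x \<in> {-1..1} \<Longrightarrow> \<bar>(deriv_I ^^ Suc r) (g m) x - G (Suc r) x\<bar> \<le> e"
          using close_G[OF e] r Suc_leI by meson
        have "norm (t * (deriv_I ^^ Suc r) (g n) x - t * G (Suc r) x) \<le> e * norm t"
          if "n \<ge> N" "x \<in> {-1..1}" for n x t
          using mult_left_mono[OF N[OF that], of "\<bar>t\<bar>"]
          unfolding right_diff_distrib[symmetric] real_norm_def abs_mult by (simp only: mult.commute abs_ge_zero)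
        then show ?thesis unfolding eventually_sequentially by blast
      qed
      show "(\<lambda>n. (deriv_I ^^ r) (g n) 0) \<longlonglongrightarrow> G r 0" using lim_G[of r 0] r by simp
    qed auto
    then obtain h where h: "\<And>x. x \<in> {-1..1} \<Longrightarrow> (\<lambda>n. (deriv_I ^^ r) (g n) x) \<longlonglongrightarrow> h x"
      "\<And>x. x \<in> {-1..1} \<Longrightarrow> (h has_derivative (\<lambda>t. t * G (Suc r) x)) (at x within {-1..1})"
      by blast
    \<comment> \<open>Termwise differentiation only yields some limit function h; pointwise limits
      identify it with \<open>G r\<close> on the interval.\<close>
    have "h y = G r y" if "y \<in> {-1..1}" for y
      using LIMSEQ_unique[OF h(1)[OF that] lim_G[of r y]] r that by simp
    then have "(G r has_derivative (\<lambda>t. t * G (Suc r) x)) (at x within {-1..1})"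
      using has_derivative_transform[OF x _ h(2)[OF x], of "G r"] by simp
    then show ?thesis by (simp add: has_vector_derivative_def)
  qed
  have D_G: "(deriv_I ^^ r) (G 0) = G r" if "r \<le> k" for r
    using that
  proof (induction r)
    case (Suc r)
    have "deriv_I (G r) x = G (Suc r) x" for x
    proof (cases "x \<in> {-1..1}")
      case True
      then have "vector_derivative (G r) (at x within {-1..1}) = G (Suc r) x"
        using deriv_G[of r x] Suc.prems
        by (intro vector_derivative_within_cbox[of "-1" 1 x, simplified box_real]) auto
      then show ?thesis using True by (simp add: deriv_I_def)
    next
      case False
      then show ?thesis by (simp only: deriv_I_def G_def if_False)
    qed
    then show ?case using Suc by auto
  qed simp
  have GX: "G 0 \<in> ?X"
  proof -
    have "(deriv_I ^^ r) (G 0) differentiable_on {-1..1}" if "r < k" for r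
      unfolding D_G[OF less_imp_le[OF that]] differentiable_on_def
      by (blast intro: differentiableI_vector deriv_G[OF that])
    moreover have "\<exists>C. \<forall>x\<in>{-1..1}. \<forall>y\<in>{-1..1}.
        \<bar>(deriv_I ^^ k) (G 0) x - (deriv_I ^^ k) (G 0) y\<bar> \<le> C * \<bar>x - y\<bar> powr \<beta>"
    proof -
      \<comment> \<open>Tolerance 1 is enough: the limit inherits the Hoelder constant of one
        approximant, increased by 1.\<close>
      obtain m where m: "\<And>x y. x \<in> {-1..1} \<Longrightarrow> y \<in> {-1..1} \<Longrightarrow> \<bar>((deriv_I ^^ k) (g m) x - G k x) -
         ((deriv_I ^^ k) (g m) y - G k y)\<bar> \<le> 1 * \<bar>x - y\<bar> powr \<beta>"
        using close_G[of 1] by (metis order_refl zero_less_one)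
      obtain C where C: "\<And>x y. x \<in> {-1..1} \<Longrightarrow> y \<in> {-1..1} \<Longrightarrow>
          \<bar>(deriv_I ^^ k) (g m) x - (deriv_I ^^ k) (g m) y\<bar> \<le> C * \<bar>x - y\<bar> powr \<beta>"
        using g[of m] unfolding holder_space_def by blast
      have "\<bar>G k x - G k y\<bar> \<le> (C + 1) * \<bar>x - y\<bar> powr \<beta>" if "x \<in> {-1..1}" "y \<in> {-1..1}" for x y
        using m[OF that] C[OF that] unfolding distrib_right by linarith
      then show ?thesis
        unfolding D_G[OF order_refl] by (intro exI[of _ "C + 1"]) blast
    qed
    moreover have "G 0 x = 0" if "x \<notin> {-1..1}" for x using that by (simp only: G_def if_False)
    ultimately show ?thesis unfolding holder_space_def by blast
  qed
  have "(\<lambda>n. holder_norm k \<beta> (g n - G 0)) \<longlonglongrightarrow> 0"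
  proof (rule LIMSEQ_I)
    fix e :: real assume e: "0 < e"
    obtain N where N: "\<And>m r x. m \<ge> N \<Longrightarrow> r \<le> k \<Longrightarrow> x \<in> {-1..1} \<Longrightarrow> \<bar>(deriv_I ^^ r) (g m) x - G r x\<bar> \<le> e / 3"
      "\<And>m x y. m \<ge> N \<Longrightarrow> x \<in> {-1..1} \<Longrightarrow> y \<in> {-1..1} \<Longrightarrow>
        \<bar>((deriv_I ^^ k) (g m) x - G k x) - ((deriv_I ^^ k) (g m) y - G k y)\<bar> \<le> e / 3 * \<bar>x - y\<bar> powr \<beta>"
    proof -
      have "0 < e / 3" using e by simp
      from close_G[OF this] show thesis using that by blast
    qed
    have "norm (holder_norm k \<beta> (g n - G 0) - 0) < e" if n: "n \<ge> N" for n
    proof -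
      have "holder_norm k \<beta> (g n - G 0) \<le> e / 3 + e / 3"
        by (rule holder_norm_le) (use N n in \<open>auto simp: D_diff[OF g GX] D_G\<close>)
      moreover have "0 \<le> holder_norm k \<beta> (g n - G 0)"
        using abs_le_holder_norm[OF subspace_diff[OF subspace_holder_space g GX] \<beta>, of n 0]
        by (meson abs_ge_zero order_trans)
      ultimately show ?thesis using e by simp
    qed
    then show "\<exists>N. \<forall>n\<ge>N. norm (holder_norm k \<beta> (g n - G 0) - 0) < e" by blast
  qed
  then show thesis by (rule that[OF GX])
qed

lemma mcomplete_holder:
  assumes \<beta>: "0 < \<beta>"
  shows "Metric_space.mcomplete (holder_space k \<beta>) (norm_dist (holder_space k \<beta>) (holder_norm k \<beta>))"
proof -
  interpret normed_subspace "holder_space k \<beta>" "holder_norm k \<beta>"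
    by (rule normed_subspace_holder[OF \<beta>])
  show ?thesis
    unfolding mcomplete_def
  proof (intro allI impI)
    fix g assume g: "MCauchy g"
    then have gX: "g n \<in> holder_space k \<beta>" for n by (auto simp: MCauchy_def)
    obtain l where "l \<in> holder_space k \<beta>" "(\<lambda>n. holder_norm k \<beta> (g n - l)) \<longlonglongrightarrow> 0"
    proof (rule holder_space_Cauchy_limit[OF \<beta> gX])
      show "\<exists>N. \<forall>m\<ge>N. \<forall>n\<ge>N. holder_norm k \<beta> (g m - g n) < e" if "0 < e" for e
      proof -
        obtain N where "\<And>m n. N \<le> m \<Longrightarrow> N \<le> n \<Longrightarrow>
            norm_dist (holder_space k \<beta>) (holder_norm k \<beta>) (g m) (g n) < e"
          using g \<open>0 < e\<close> unfolding MCauchy_def by blast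
        then show ?thesis by (intro exI[of _ N]) (simp add: norm_dist_eq gX)
      qed
    qed
    then show "\<exists>l. limitin mtopology g l sequentially"
      using gX by (auto simp: limitin_iff_nrm_tendsto)
  qed
qed

section \<open>Chebyshev expansions\<close>

lemma deriv_I_restricted_poly:
  "deriv_I (\<lambda>x. if x \<in> {-1..1} then poly p x else 0) =
     (\<lambda>x. if x \<in> {-1..1} then poly (pderiv p) x else 0)"
  (is "deriv_I ?p = _")
proof
  fix x :: real
  show "deriv_I ?p x = (if x \<in> {-1..1} then poly (pderiv p) x else 0)"
  proof (cases "x \<in> {-1..1}")
    case True
    have "(poly p has_vector_derivative poly (pderiv p) x) (at x within {-1..1})"
      using poly_DERIV[of p x]
      by (simp add: has_real_derivative_iff_has_vector_derivative has_vector_derivative_at_within)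
    then have "(?p has_vector_derivative poly (pderiv p) x) (at x within {-1..1})"
      by (rule has_vector_derivative_transform[OF True, rotated]) simp
    then have "vector_derivative ?p (at x within {-1..1}) = poly (pderiv p) x"
      using True by (intro vector_derivative_within_cbox[of "-1" 1 x, simplified box_real]) auto
    then show ?thesis using True by (simp only: deriv_I_def if_True)
  next
    case False
    then show ?thesis by (simp only: deriv_I_def if_False)
  qed
qed

lemma deriv_I_funpow_restricted_poly:
  "(deriv_I ^^ r) (\<lambda>x. if x \<in> {-1..1} then poly p x else 0) =
     (\<lambda>x. if x \<in> {-1..1} then poly ((pderiv ^^ r) p) x else 0)"
proof (induction r)
  case (Suc r)
  then show ?case
    by (simp only: funpow.simps o_apply deriv_I_restricted_poly)
qed (simp only: funpow.simps id_apply)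

text \<open>A bound on the next derivative makes the k-th one Lipschitz, and on an interval of
  length 2 a Lipschitz bound is a Hoelder bound of exponent \<beta> up to a factor 2.\<close>

lemma restricted_poly_in_holder_space:
  assumes \<beta>: "0 < \<beta>" "\<beta> \<le> 1"
  shows "(\<lambda>x. if x \<in> {-1..1} then poly p x else 0) \<in> holder_space k \<beta>"
  unfolding holder_space_def mem_Collect_eq deriv_I_funpow_restricted_poly
proof (intro conjI allI impI)
  show "(\<lambda>x. if x \<in> {-1..1} then poly ((pderiv ^^ r) p) x else 0) differentiable_on {-1..1}" for r
    unfolding differentiable_on_def
  proof
    fix x :: real assume x: "x \<in> {-1..1}"
    have "poly ((pderiv ^^ r) p) differentiable (at x within {-1..1})"
      by (meson differentiable_at_withinI poly_differentiable)
    then show "(\<lambda>x. if x \<in> {-1..1} then poly ((pderiv ^^ r) p) x else 0) differentiable (at x within {-1..1})"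
      by (rule differentiable_transform_within[OF _ zero_less_one x]) (simp only: if_True)
  qed
  let ?q = "(pderiv ^^ k) p"
  have "compact ((\<lambda>x. poly (pderiv ?q) x) ` {-1..1})"
    by (intro compact_continuous_image continuous_intros) auto
  then have "bounded (poly (pderiv ?q) ` {-1..1})" by (rule compact_imp_bounded)
  then obtain B where "\<forall>y\<in>poly (pderiv ?q) ` {-1..1}. norm y \<le> B"
    unfolding bounded_iff by blast
  then have B: "\<bar>poly (pderiv ?q) x\<bar> \<le> B" if "x \<in> {-1..1}" for x
    using that by simp
  have "\<bar>poly ?q x - poly ?q y\<bar> \<le> 2 * B * \<bar>x - y\<bar> powr \<beta>" if "x \<in> {-1..1}" "y \<in> {-1..1}" for x y
  proof -
    have B0: "0 \<le> B" using B[of 0] by simp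
    have "\<bar>poly ?q x - poly ?q y\<bar> \<le> B * \<bar>x - y\<bar>"
    proof -
      have "norm (poly ?q x - poly ?q y) \<le> B * norm (x - y)"
        by (rule field_differentiable_bound[of "{-1..1}" "poly ?q" "poly (pderiv ?q)"])
          (use B that in \<open>auto intro: has_field_derivative_at_within poly_DERIV\<close>)
      then show ?thesis by simp
    qed
    also have "B * \<bar>x - y\<bar> \<le> B * (2 * \<bar>x - y\<bar> powr \<beta>)"
    proof (intro mult_left_mono B0)
      show "\<bar>x - y\<bar> \<le> 2 * \<bar>x - y\<bar> powr \<beta>"
      proof (cases "x = y")
        case False
        \<comment> \<open>Distances reach 2, and t \<le> \<open>t powr \<beta>\<close> holds only up
          to 1. Halving brings them into range and costs the factor 2.\<close>
        define t where "t = \<bar>x - y\<bar> / 2"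
        have t: "0 < t" "t \<le> 1" using False that by (auto simp: t_def)
        have "t powr 1 \<le> t powr \<beta>" using t \<beta> by (intro powr_mono') auto
        also have "\<dots> \<le> \<bar>x - y\<bar> powr \<beta>" using t \<beta> by (intro powr_mono2) (auto simp: t_def)
        finally show ?thesis using t by (simp add: t_def)
      qed simp
    qed
    finally show ?thesis by (simp add: mult_ac)
  qed
  then show "\<exists>C. \<forall>x\<in>{-1..1}. \<forall>y\<in>{-1..1}.
      \<bar>(if x \<in> {-1..1} then poly ?q x else 0) - (if y \<in> {-1..1} then poly ?q y else 0)\<bar> \<le> C * \<bar>x - y\<bar> powr \<beta>"
    by (intro exI[of _ "2 * B"]) simp
qed auto

lemma cheb_polynomial: "\<exists>p. cheb j = poly p"
\<comment> \<open>The induction rule of \<open>cheb\<close> also carries the argument x, which the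
  predicate ignores; the 0 is a dummy for it.\<close>
proof (induction j rule: cheb.induct[of "\<lambda>j _. \<exists>p. cheb j = poly p" _ 0, case_names 0 1 2])
  case 0
  show ?case by (rule exI[of _ "[:1:]"]) (simp add: fun_eq_iff)
next
  case 1
  show ?case by (rule exI[of _ "[:0, 1:]"]) (simp add: fun_eq_iff)
next
  case (2 j x)
  then obtain p q where "cheb j = poly p" "cheb (Suc j) = poly q" by blast
  then show ?case
    by (intro exI[of _ "[:0, 2:] * q - p"]) (simp add: fun_eq_iff)
qed

lemma cheb_I_in_holder_space:
  assumes "0 < \<beta>" "\<beta> \<le> 1"
  shows "cheb_I j \<in> holder_space k \<beta>"
proof -
  obtain p where "cheb j = poly p" using cheb_polynomial by blast
  then have "cheb_I j = (\<lambda>x. if x \<in> {-1..1} then poly p x else 0)"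
    by (simp only: cheb_I_def)
  then show ?thesis
    by (simp only: restricted_poly_in_holder_space[OF assms])
qed

lemma continuous_on_cheb: "continuous_on S (cheb j)"
  using cheb_polynomial[of j] by (auto intro!: continuous_intros)

text \<open>The antiderivative arcsin is continuous up to the endpoints, so its derivative is needed
  only inside, away from the singularities. At the endpoints the quotient is 0 by the convention for
  division by 0.\<close>

lemma Chebyshev_weight_absolutely_integrable:
  "(\<lambda>s::real. 1 / sqrt (1 - s\<^sup>2)) absolutely_integrable_on {-1..1}"
proof (rule nonnegative_absolutely_integrable_1)
  have "((\<lambda>s. 1 / sqrt (1 - s\<^sup>2)) has_integral arcsin 1 - arcsin (-1)) {-1..1}"
  proof (rule fundamental_theorem_of_calculus_interior)
    show "(arcsin has_vector_derivative 1 / sqrt (1 - x\<^sup>2)) (at x)" if "x \<in> {-1<..<1}" for x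
      using DERIV_arcsin[of x] that
      by (simp add: has_real_derivative_iff_has_vector_derivative inverse_eq_divide)
    show "continuous_on {-1..1} arcsin" by (rule continuous_on_arcsin')
  qed simp
  then show "(\<lambda>s. 1 / sqrt (1 - s\<^sup>2)) integrable_on {-1..1}" by blast
  show "0 \<le> 1 / sqrt (1 - s\<^sup>2)" if "s \<in> {-1..1}" for s :: real
    using that by (simp add: abs_square_le_1 abs_le_iff)
qed

lemma holder_space_continuous_on:
  assumes h: "h \<in> holder_space k \<beta>" and \<beta>: "0 < \<beta>"
  shows "continuous_on {-1..1} h"
proof (cases "k = 0")
  case True
  obtain C where "\<And>x y. x \<in> {-1..1} \<Longrightarrow> y \<in> {-1..1} \<Longrightarrow>
      \<bar>(deriv_I ^^ k) h x - (deriv_I ^^ k) h y\<bar> \<le> C * \<bar>x - y\<bar> powr \<beta>"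
    using h unfolding holder_space_def by blast
  then have C: "\<bar>h x - h y\<bar> \<le> C * \<bar>x - y\<bar> powr \<beta>" if "x \<in> {-1..1}" "y \<in> {-1..1}" for x y
    using that True by simp
  show ?thesis
    unfolding continuous_on_def
  proof
    fix x :: real assume x: "x \<in> {-1..1}"
    have "((\<lambda>y. \<bar>y - x\<bar> powr \<beta>) \<longlongrightarrow> 0) (at x within {-1..1})"
      using \<beta> by (auto intro!: tendsto_eq_intros)
    then have "((\<lambda>y. C * \<bar>y - x\<bar> powr \<beta>) \<longlongrightarrow> 0) (at x within {-1..1})"
      by (rule tendsto_mult_right_zero)
    moreover have "\<forall>\<^sub>F y in at x within {-1..1}. norm (h y - h x) \<le> C * \<bar>y - x\<bar> powr \<beta>"
      using C x by (auto simp: eventually_at_filter)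
    ultimately have "((\<lambda>y. h y - h x) \<longlongrightarrow> 0) (at x within {-1..1})"
      by (rule Lim_null_comparison[rotated])
    then show "(h \<longlongrightarrow> h x) (at x within {-1..1})" by (simp add: LIM_zero_iff)
  qed
next
  case False
  then have "(deriv_I ^^ 0) h differentiable_on {-1..1}"
    using h unfolding holder_space_def by blast
  then show ?thesis by (simp add: differentiable_imp_continuous_on)
qed

text \<open>Since \<open>integral\<close> is 0 on functions that are not integrable, additivity of
  the coefficients has to rest on integrability: a bounded continuous factor times an absolutely
  integrable weight.\<close>

lemma cheb_coeff_integrable:
  assumes h: "h \<in> holder_space k \<beta>" and \<beta>: "0 < \<beta>"
  shows "(\<lambda>s. h s * cheb j s / sqrt (1 - s\<^sup>2)) integrable_on {-1..1}"
proof -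
  have cont: "continuous_on {-1..1} (\<lambda>s. h s * cheb j s)"
    by (intro continuous_intros holder_space_continuous_on[OF h \<beta>] continuous_on_cheb)
  have "(\<lambda>s. (h s * cheb j s) *\<^sub>R (1 / sqrt (1 - s\<^sup>2))) absolutely_integrable_on {-1..1}"
  proof (rule absolutely_integrable_bounded_measurable_product_real[OF _ _ _ Chebyshev_weight_absolutely_integrable, simplified real_scaleR_def[symmetric]])
    show "(\<lambda>s. h s * cheb j s) \<in> borel_measurable (lebesgue_on {-1..1})"
      by (rule continuous_imp_measurable_on_sets_lebesgue[OF cont]) simp
    show "bounded ((\<lambda>s. h s * cheb j s) ` {-1..1})"
      by (intro compact_imp_bounded compact_continuous_image cont) simp
  qed simp
  then show ?thesis
    by (simp add: absolutely_integrable_on_def)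
qed

lemma cheb_coeff_add:
  assumes "h \<in> holder_space k \<beta>" "g \<in> holder_space k \<beta>" "0 < \<beta>"
  shows "cheb_coeff (h + g) j = cheb_coeff h j + cheb_coeff g j"
proof -
  have "integral {-1..1} (\<lambda>s. (h + g) s * cheb j s / sqrt (1 - s\<^sup>2)) =
      integral {-1..1} (\<lambda>s. h s * cheb j s / sqrt (1 - s\<^sup>2) + g s * cheb j s / sqrt (1 - s\<^sup>2))"
    by (simp add: distrib_right add_divide_distrib)
  also have "\<dots> = integral {-1..1} (\<lambda>s. h s * cheb j s / sqrt (1 - s\<^sup>2)) +
      integral {-1..1} (\<lambda>s. g s * cheb j s / sqrt (1 - s\<^sup>2))"
    by (rule integral_add) (rule cheb_coeff_integrable assms)+
  finally show ?thesis by (simp add: cheb_coeff_def distrib_left)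
qed

lemma cheb_coeff_scaleR: "cheb_coeff (c *\<^sub>R h) j = c * cheb_coeff h j"
proof -
  have "integral {-1..1} (\<lambda>s. (c *\<^sub>R h) s * cheb j s / sqrt (1 - s\<^sup>2)) =
      c * integral {-1..1} (\<lambda>s. h s * cheb j s / sqrt (1 - s\<^sup>2))"
    using integral_mult_right[of "{-1..1}" c "\<lambda>s. h s * cheb j s / sqrt (1 - s\<^sup>2)"]
    by (simp add: mult.assoc)
  then show ?thesis by (simp add: cheb_coeff_def)
qed

lemma cheb_proj_add:
  assumes "h \<in> holder_space k \<beta>" "g \<in> holder_space k \<beta>" "0 < \<beta>"
  shows "cheb_proj N (h + g) = cheb_proj N h + cheb_proj N g"
  unfolding cheb_proj_def
  by (simp add: cheb_coeff_add[OF assms] scaleR_add_left sum.distrib)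

lemma cheb_proj_scaleR: "cheb_proj N (c *\<^sub>R h) = c *\<^sub>R cheb_proj N h"
  by (simp add: cheb_proj_def cheb_coeff_scaleR scaleR_sum_right)

lemma cheb_proj_in_span: "cheb_proj N h \<in> span (cheb_I ` {..N})"
  unfolding cheb_proj_def by (intro span_sum span_scale span_base) auto

text \<open>The interior point u supplies a ball inside D on which T takes values in R. For u = T u
  + f only the summand T u is sure to lie in R; convergence of the projections at f is supplied by
  \<open>P_conv_f\<close>. The solutions compared with u are those within \<delta> of it; no
  estimate is claimed for solutions farther away.\<close>

theorem theorem3p5:
  fixes k :: nat and \<beta> \<gamma> L :: real
    and X :: "(real \<Rightarrow> real) set" and nrm :: "(real \<Rightarrow> real) \<Rightarrow> real"
    and T :: "(real \<Rightarrow> real) \<Rightarrow> real \<Rightarrow> real"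
    and T' :: "(real \<Rightarrow> real) \<Rightarrow> (real \<Rightarrow> real) \<Rightarrow> real \<Rightarrow> real"
    and f u :: "real \<Rightarrow> real" and D R :: "(real \<Rightarrow> real) set"
  assumes beta: "0 < \<beta>" "\<beta> < 1 / 2"
    and X_def: "X = holder_space k \<beta>"
    and nrm_def: "nrm = holder_norm k \<beta>"
    and T_maps: "T \<in> X \<rightarrow> X"
    and T_integral: "integral_operator X T"
    and f: "f \<in> X"
    and u_isolated: "isolated_fixed_point X nrm (\<lambda>y. T y + f) u"
    and u_index: "ls_index X nrm (\<lambda>y. T y + f) u \<noteq> 0"
    and T_cc: "completely_continuous X nrm T"
    and T_deriv: "\<And>y. y \<in> X \<Longrightarrow> has_frechet_derivative X nrm T (T' y) y"
    and T'_bound: "\<And>y h. y \<in> X \<Longrightarrow> h \<in> X \<Longrightarrow> nrm (T' y h) \<le> L * nrm h"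
    and D_domain: "closed_domain X nrm D"
    and D_bounded: "norm_bounded X nrm D"
    and u_D: "u \<in> norm_topology X nrm interior_of D"
    and gamma: "2 * \<beta> < \<gamma>" "\<gamma> \<le> 1"
    and T_D: "T ` D \<subseteq> holder_space k \<gamma>"
    and T_D_inf: "(INF y\<in>D. nrm (T y)) > 0"
    and T_D_sup: "bdd_above ((\<lambda>y. holder_norm k \<gamma> (T y)) ` D)"
    and R_def: "R = closed_linear_hull X nrm (T ` D)"
    and P_bounded: "\<exists>M. \<forall>N. \<forall>y\<in>R. nrm (cheb_proj N y) \<le> M * nrm y"
    and P_conv: "\<And>y. y \<in> R \<Longrightarrow> (\<lambda>N. nrm (y - cheb_proj N y)) \<longlonglongrightarrow> 0"
    and P_conv_f: "(\<lambda>N. nrm (f - cheb_proj N f)) \<longlonglongrightarrow> 0"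
    and no_eigenvalue: "\<not> eigenvalue_on X (T' u) 1"
  shows "\<exists>\<delta>>0.
     (\<forall>\<^sub>F N in sequentially. \<exists>v\<in>cheb_space N.
        nrm (v - u) < \<delta> \<and> cheb_proj N (T v) + cheb_proj N f = v) \<and>
     (\<forall>uN.
        (\<forall>\<^sub>F N in sequentially. uN N \<in> cheb_space N \<and> nrm (uN N - u) < \<delta> \<and>
           cheb_proj N (T (uN N)) + cheb_proj N f = uN N) \<longrightarrow>
        (\<lambda>N. nrm (u - uN N)) \<longlonglongrightarrow> 0 \<and>
        (\<lambda>N. nrm (cheb_proj N u - u)) \<longlonglongrightarrow> 0 \<and>
        (\<exists>c\<^sub>1>0. \<exists>c\<^sub>2>0. \<forall>\<^sub>F N in sequentially.
           c\<^sub>1 * nrm (cheb_proj N u - u) \<le> nrm (uN N - u) \<and>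
           nrm (uN N - u) \<le> c\<^sub>2 * nrm (cheb_proj N u - u)))"
proof -
  interpret normed_subspace X nrm
    unfolding X_def nrm_def by (rule normed_subspace_holder[OF beta(1)])
  have cheb_X: "cheb_I j \<in> X" for j
    unfolding X_def using beta by (intro cheb_I_in_holder_space) auto
  have u: "u \<in> X" "T u + f = u"
    using u_isolated by (simp_all add: isolated_fixed_point_def)
  have D_X: "D \<subseteq> X"
  proof -
    obtain \<Omega> where "D = mtopology closure_of \<Omega>"
      using D_domain unfolding closed_domain_def by blast
    then show ?thesis using closure_of_subset_topspace[of mtopology \<Omega>] by simp
  qed
  define \<V> where "\<V> = {V. subspace V \<and> closedin mtopology V \<and> T ` D \<subseteq> V}"
  have R: "R = \<Inter>\<V>" by (simp add: R_def closed_linear_hull_def \<V>_def)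
  \<comment> \<open>The family has to be non-empty for its intersection to be closed in X: the empty
    intersection would be the whole type.\<close>
  have "X \<in> \<V>"
    using subspace_carrier T_maps D_X closedin_topspace[of mtopology] by (auto simp: \<V>_def)
  then have R_closed: "closedin mtopology R"
    unfolding R by (intro closedin_Inter) (auto simp: \<V>_def)
  have R_subspace: "subspace R"
    unfolding R by (rule subspace_Inter) (simp add: \<V>_def)
  have T_R: "T y \<in> R" if "y \<in> D" for y
    using that by (auto simp: R \<V>_def)
  obtain d where d: "0 < d" "mball u d \<subseteq> mtopology interior_of D"
    using u_D openin_interior_of[of mtopology D] unfolding openin_mtopology by blast
  have ball_R: "T y \<in> R" if "y \<in> X" "nrm (y - u) < d" for y
  proof -
    have "y \<in> mball u d"
      using that u by (simp add: norm_dist_eq nrm_minus_commute)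
    then show ?thesis using d(2) interior_of_subset[of mtopology D] T_R by blast
  qed
  obtain M where M: "\<And>N y. y \<in> R \<Longrightarrow> nrm (cheb_proj N y) \<le> M * nrm y"
    using P_bounded by blast
  show ?thesis
    unfolding cheb_space_def
  proof (rule projection_method[where P = cheb_proj and A = "T' u" and R = R and M = M and d = d])
    show mcomplete unfolding X_def nrm_def by (rule mcomplete_holder[OF beta(1)])
    show "cheb_I ` {..N} \<subseteq> X" for N using cheb_X by blast
    show "cheb_proj N (x + y) = cheb_proj N x + cheb_proj N y" if "x \<in> X" "y \<in> X" for N x y
      using that beta(1) unfolding X_def by (rule cheb_proj_add)
  qed (use T_maps T_cc u f T_deriv no_eigenvalue R_subspace R_closed d(1) ball_R M P_conv P_conv_f
      in \<open>auto simp: cheb_proj_scaleR cheb_proj_in_span\<close>)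
qed

end
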